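(* Let $K$ be a compact metrizable strongly countable-dimensional space. Then $K$ is $u$-dominated by the unit interval, i.e. there exists a uniformly continuous surjection $\varphi:C_p([0,1])\to C_p(K)$.
   Context: For a Tychonoff space $X$, $C_p(X)$ is the space of all continuous real-valued functions on $X$ with the topology of pointwise convergence. A map $\varphi:C_p(X)\to C_p(Y)$ is uniformly continuous if for each open neighborhood $U$ of the zero function in $C_p(Y)$ there is an open neighborhood $V$ of the zero function in $C_p(X)$ such that $f-g\in V$ implies $\varphi(f)-\varphi(g)\in U$. A space $Y$ is $u$-dominated by $X$ if there is a uniformly continuous surjection $C_p(X)\to C_p(Y)$. A normal space is strongly countable-dimensional if it is a countable union of closed finite-dimensional subspaces (covering dimension). *)

theory Defs
  imports "HOL-Analysis.Analysis"
begin

(* Elements of the product topology are functions that are undefined outside topspace X, so two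
   points of Cp X are equal iff they agree on topspace X.  The separation axiom (Tychonoff) is not
   part of the definition. *)
definition Cp :: "'a topology \<Rightarrow> ('a \<Rightarrow> real) topology" where
  "Cp X = subtopology (product_topology (\<lambda>_. euclideanreal) (topspace X))
                      {f. continuous_map X euclideanreal f}"

(* The vector space operations of Cp X have to be restricted to topspace X to stay in Cp X. *)
definition Cp_zero :: "'a topology \<Rightarrow> 'a \<Rightarrow> real" where
  "Cp_zero X = (\<lambda>x\<in>topspace X. 0)"

definition Cp_diff :: "'a topology \<Rightarrow> ('a \<Rightarrow> real) \<Rightarrow> ('a \<Rightarrow> real) \<Rightarrow> 'a \<Rightarrow> real" where
  "Cp_diff X f g = (\<lambda>x\<in>topspace X. f x - g x)"

lemma Cp_zero_in: "Cp_zero X \<in> topspace (Cp X)"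
  by (auto simp: Cp_def Cp_zero_def intro: continuous_map_eq[of X _ "\<lambda>_. 0"])

lemma Cp_diff_in:
  assumes "f \<in> topspace (Cp X)" "g \<in> topspace (Cp X)"
  shows "Cp_diff X f g \<in> topspace (Cp X)"
  using assms
  by (auto simp: Cp_def Cp_diff_def intro: continuous_map_eq[of X _ "\<lambda>x. f x - g x"]
      continuous_map_diff)

definition Cp_uniformly_continuous ::
  "'a topology \<Rightarrow> 'b topology \<Rightarrow> (('a \<Rightarrow> real) \<Rightarrow> ('b \<Rightarrow> real)) \<Rightarrow> bool" where
  "Cp_uniformly_continuous X Y \<phi> \<longleftrightarrow>
     \<phi> \<in> topspace (Cp X) \<rightarrow> topspace (Cp Y) \<and>
     (\<forall>U. openin (Cp Y) U \<and> Cp_zero Y \<in> U \<longrightarrow>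
       (\<exists>V. openin (Cp X) V \<and> Cp_zero X \<in> V \<and>
         (\<forall>f\<in>topspace (Cp X). \<forall>g\<in>topspace (Cp X).
            Cp_diff X f g \<in> V \<longrightarrow> Cp_diff Y (\<phi> f) (\<phi> g) \<in> U)))"

definition u_dominated_by :: "'b topology \<Rightarrow> 'a topology \<Rightarrow> bool" where
  "u_dominated_by Y X \<longleftrightarrow>
     (\<exists>\<phi>. Cp_uniformly_continuous X Y \<phi> \<and> \<phi> ` topspace (Cp X) = topspace (Cp Y))"

definition open_cover :: "'a topology \<Rightarrow> 'a set set \<Rightarrow> bool" where
  "open_cover X \<U> \<longleftrightarrow> (\<forall>U\<in>\<U>. openin X U) \<and> \<Union>\<U> = topspace X"

(* Covering dimension dim X \<le> n in the sense of Cech-Lebesgue, by finite covers, as usual for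
   normal spaces.  Not to be confused with the library's dimension_le, which is the small
   inductive dimension. *)
definition covering_dim_le :: "'a topology \<Rightarrow> nat \<Rightarrow> bool" where
  "covering_dim_le X n \<longleftrightarrow>
     (\<forall>\<U>. finite \<U> \<and> open_cover X \<U> \<longrightarrow>
       (\<exists>\<V>. finite \<V> \<and> open_cover X \<V> \<and> (\<forall>V\<in>\<V>. \<exists>U\<in>\<U>. V \<subseteq> U) \<and>
         (\<forall>x\<in>topspace X. card {V \<in> \<V>. x \<in> V} \<le> n + 1)))"

definition finite_dimensional :: "'a topology \<Rightarrow> bool" where
  "finite_dimensional X \<longleftrightarrow> (\<exists>n. covering_dim_le X n)"

definition strongly_countable_dimensional :: "'a topology \<Rightarrow> bool" where
  "strongly_countable_dimensional X \<longleftrightarrow>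
     normal_space X \<and>
     (\<exists>\<F>. countable \<F> \<and> \<Union>\<F> = topspace X \<and>
        (\<forall>F\<in>\<F>. closedin X F \<and> finite_dimensional (subtopology X F)))"

end

theory Submission
  imports Defs
begin

text \<open>
The topology of pointwise convergence makes a map \<open>\<phi>\<close> between function spaces uniformly continuous as soon
as every value \<open>\<phi> G y\<close> is a Lipschitz function of finitely many values of \<open>G\<close>. So the task is to find a
recipe that turns \<^emph>\<open>every\<close> continuous \<open>G\<close> on the unit interval into a continuous function on \<open>K\<close>, that uses
only finitely many values of \<open>G\<close> for each point of \<open>K\<close>, and that reaches all continuous functions.

Let \<open>K\<close> be the union of the closed finite-dimensional sets \<open>F 0, F 1, ...\<close>. On each \<open>F n\<close> all continuous
functions \<open>h\<close> are sums of finitely many terms \<open>g i \<circ> \<psi> i\<close>, where the inner functions \<open>\<psi> i\<close> are fixed and the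
outer functions \<open>g i\<close> live on the unit interval and are bounded by \<open>2 * sup \<bar>h\<bar>\<close>. This is the superposition
theorem of Kolmogorov and Ostrand (\<open>kolmogorov_superposition\<close>); it is derived from covers of order \<open>n + 1\<close>
(\<open>disjoint_small_families\<close>). The inner functions extend to \<open>K\<close>, so that a function on \<open>F n\<close> and an extension
of it are coded by finitely many functions of one variable.

A function \<open>G\<close> on the unit interval carries a whole sequence of such functions on disjoint intervals that
shrink to 0; apart from continuity the only constraint on the sequence is that it tends to zero
(\<open>continuous_function_with_prescribed_pieces\<close>). From these pieces one builds approximations \<open>e 0, e 1, ...\<close>,
where \<open>e (n + 1)\<close> arises from \<open>e n\<close> by a correction meant for \<open>F n\<close>. Since \<open>G\<close> is arbitrary, the corrections
have to be tamed: all later approximations are truncated so as to stay within \<open>\<rho> n\<close> of \<open>e n\<close>, where \<open>\<rho> n\<close> is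
also read off from \<open>G\<close>, vanishes on \<open>F 0, ..., F (n - 1)\<close>, and tends to zero uniformly (\<open>next_stage\<close>). Hence the
approximations become constant after finitely many steps at every point, which gives the finite dependence
on \<open>G\<close>, and they converge uniformly, which gives continuity of the limit. The truncations never conflict, as
\<open>e n\<close> itself satisfies all requirements made before step \<open>n\<close> and the new one.

To reach a given \<open>f\<close>, let the \<open>n\<close>-th group of pieces code \<open>f - e n\<close> (\<open>glue_surj\<close>). This is only possible if
\<open>f - e n\<close> tends to zero uniformly. Therefore the recipe first truncates the corrected function to a neighbourhood of a
finite average, which for the intended pieces is the average of \<open>f\<close> over a partition of unity of mesh
\<open>1 / (n + 1)\<close> (\<open>admissible_next\<close>).
\<close>

section \<open>Finite-dimensional compacta and disjoint families of small sets\<close>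

text \<open>Take functions \<open>p V\<close>, positive exactly on the members \<open>V\<close> of an open cover in which
every point lies in at most \<open>n + 1\<close> members, and for a threshold \<open>t i\<close> sort the points by the set of those
\<open>V\<close> with \<open>p V x\<close> above \<open>t i\<close>. Points with different such sets are separated as long as no value
\<open>p V x\<close> lies within \<open>\<kappa>\<close> of the threshold. Of the at most \<open>n + 1\<close> positive values at \<open>x\<close> one
exceeds every threshold, so at most \<open>n\<close> values can be near a threshold; as the thresholds are far apart,
each of these spoils only one of them.\<close>

lemma disjoint_small_families:
  fixes F :: "'b::metric_space set"
  assumes F: "compact F" and dim: "covering_dim_le (top_of_set F) n" and \<delta>: "\<delta> > 0"
  obtains \<W> :: "nat \<Rightarrow> 'b set set" where
    "\<And>i. finite (\<W> i)"
    "\<And>i Z. Z \<in> \<W> i \<Longrightarrow> closed Z \<and> Z \<subseteq> F"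
    "\<And>i Z x y. Z \<in> \<W> i \<Longrightarrow> x \<in> Z \<Longrightarrow> y \<in> Z \<Longrightarrow> dist x y < \<delta>"
    "\<And>i. pairwise disjnt (\<W> i)"
    "\<And>x. x \<in> F \<Longrightarrow> card {i. i < N \<and> x \<notin> \<Union>(\<W> i)} \<le> n"
proof (cases "F = {}")
  case True
  then show ?thesis
    by (intro that[of "\<lambda>_. {}"]) (auto simp: pairwise_def)
next
  case False
  have "\<exists>\<U>. finite \<U> \<and> open_cover (top_of_set F) \<U> \<and> (\<forall>U\<in>\<U>. \<forall>x\<in>U. \<forall>y\<in>U. dist x y < \<delta>)"
  proof -
    obtain C where C: "C \<subseteq> F" "finite C" "F \<subseteq> (\<Union>c\<in>C. ball c (\<delta>/2))"
      using compactE_image[OF F, of F "\<lambda>c. ball c (\<delta>/2)"] \<delta>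
      by (metis (no_types, lifting) UN_iff centre_in_ball half_gt_zero open_ball subsetI)
    have "dist x y < \<delta>" if "x \<in> ball c (\<delta>/2)" "y \<in> ball c (\<delta>/2)" for c x y :: 'b
      using that by (metis dist_triangle_half_r mem_ball)
    with C show ?thesis
      by (intro exI[of _ "(\<lambda>c. F \<inter> ball c (\<delta>/2)) ` C"]) (auto simp: open_cover_def)
  qed
  then obtain \<U> where \<U>: "finite \<U>" "open_cover (top_of_set F) \<U>"
    and small: "\<And>U x y. U \<in> \<U> \<Longrightarrow> x \<in> U \<Longrightarrow> y \<in> U \<Longrightarrow> dist x y < \<delta>"
    by blast
  obtain \<V> where \<V>: "finite \<V>" "open_cover (top_of_set F) \<V>" "\<And>V. V \<in> \<V> \<Longrightarrow> \<exists>U\<in>\<U>. V \<subseteq> U"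
    "\<And>x. x \<in> F \<Longrightarrow> card {V\<in>\<V>. x \<in> V} \<le> n + 1"
    using dim[unfolded covering_dim_le_def, rule_format, OF conjI[OF \<U>]] by auto
  have opV: "openin (top_of_set F) V" if "V \<in> \<V>" for V
    using \<V>(2) that by (auto simp: open_cover_def)
  have UV: "\<Union>\<V> = F" using \<V>(2) by (auto simp: open_cover_def)
  define p where "p V x = (if V = F then 1 else infdist x (F - V))" for V x
  have p_cont: "continuous_on F (p V)" for V
    by (cases "V = F") (auto simp: p_def[abs_def] intro!: continuous_intros)
  have p_nonneg: "p V x \<ge> 0" for V x
    by (auto simp: p_def infdist_nonneg)
  have p_pos: "p V x > 0 \<longleftrightarrow> x \<in> V" if "V \<in> \<V>" "x \<in> F" for V x
  proof (cases "V = F")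
    case False
    have "V \<subseteq> F" using UV that by auto
    have "closedin (top_of_set F) (F - V)" using opV[OF that(1)] closedin_diff[of "top_of_set F" F V] by simp
    then have "closed (F - V)" using F by (meson closedin_compact_eq compact_imp_closed)
    moreover have "F - V \<noteq> {}" using False \<open>V \<subseteq> F\<close> by blast
    ultimately have "infdist x (F - V) = 0 \<longleftrightarrow> x \<in> F - V"
      by (metis in_closed_iff_infdist_zero)
    then show ?thesis using that False infdist_nonneg[of x "F - V"]
      by (auto simp: p_def less_le)
  qed (use that in \<open>auto simp: p_def\<close>)
  obtain x0 where x0: "x0 \<in> F" "\<And>x. x \<in> F \<Longrightarrow> (\<Sum>V\<in>\<V>. p V x0) \<le> (\<Sum>V\<in>\<V>. p V x)"
    using continuous_attains_inf[OF F False, of "\<lambda>x. \<Sum>V\<in>\<V>. p V x"] p_cont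
    by (auto intro!: continuous_intros)
  define c where "c = (\<Sum>V\<in>\<V>. p V x0) / card \<V>"
  have "\<V> \<noteq> {}" using UV False by auto
  then have card\<V>: "card \<V> > 0" using \<V>(1) by (simp add: card_gt_0_iff)
  have c_pos: "c > 0"
  proof -
    obtain V where "V \<in> \<V>" "x0 \<in> V" using UV x0 by blast
    then have "(\<Sum>V\<in>\<V>. p V x0) > 0"
      by (intro sum_pos2[OF \<V>(1), of V]) (use p_pos x0 p_nonneg in auto)
    then show ?thesis using card\<V> by (simp add: c_def)
  qed
  have large: "\<exists>V\<in>\<V>. p V x \<ge> c" if "x \<in> F" for x
  proof (rule ccontr)
    assume "\<not> ?thesis"
    then have "(\<Sum>V\<in>\<V>. p V x) < (\<Sum>V\<in>\<V>. c)"
      by (intro sum_strict_mono) (use \<V> \<open>\<V> \<noteq> {}\<close> in auto)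
    then show False using x0(2)[OF that] card\<V> by (simp add: c_def)
  qed
  \<comment> \<open>The windows of radius \<open>\<kappa>\<close> around the thresholds are disjoint and contained in the interval from 0 to \<open>c\<close>.\<close>
  define \<kappa> where "\<kappa> = c / (3 * (real N + 1))"
  have \<kappa>: "\<kappa> > 0" using c_pos by (simp add: \<kappa>_def)
  define t where "t i = 3 * \<kappa> * (real i + 1)" for i
  have t_lower: "t i - \<kappa> > 0" for i
  proof -
    have "3 * \<kappa> * 1 \<le> t i" unfolding t_def by (intro mult_left_mono) (use \<kappa> in auto)
    then show ?thesis using \<kappa> by linarith
  qed
  have t_upper: "t i + \<kappa> \<le> c" if "i < N" for i
  proof -
    have "t i \<le> 3 * \<kappa> * real N" unfolding t_def by (intro mult_left_mono) (use \<kappa> that in auto)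
    moreover have "3 * \<kappa> * (real N + 1) = c" by (simp add: \<kappa>_def field_simps)
    ultimately show ?thesis using \<kappa> by (simp add: algebra_simps)
  qed
  have t_sep: "i = j" if "\<bar>a - t i\<bar> < \<kappa>" "\<bar>a - t j\<bar> < \<kappa>" for a i j
  proof (rule ccontr)
    assume "i \<noteq> j"
    then have "1 \<le> \<bar>real i - real j\<bar>" by linarith
    then have "3 * \<kappa> * 1 \<le> 3 * \<kappa> * \<bar>real i - real j\<bar>" using \<kappa> by (intro mult_left_mono) auto
    also have "\<dots> = \<bar>t i - t j\<bar>" using \<kappa> by (simp add: t_def abs_mult flip: right_diff_distrib)
    finally show False using that \<kappa> by linarith
  qed
  define Z where "Z i S = {x\<in>F. (\<forall>V\<in>S. t i + \<kappa> \<le> p V x) \<and> (\<forall>V\<in>\<V>-S. p V x \<le> t i - \<kappa>)}" for i S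
  define \<W> where "\<W> i = Z i ` (Pow \<V> - {{}})" for i
  show ?thesis
  proof (rule that[of \<W>])
    show "finite (\<W> i)" for i using \<V>(1) by (simp add: \<W>_def)
    show "closed A \<and> A \<subseteq> F" if "A \<in> \<W> i" for A i
    proof -
      obtain S where S: "A = Z i S" using \<open>A \<in> \<W> i\<close> unfolding \<W>_def by blast
      have 1: "closed {x\<in>F. t i + \<kappa> \<le> p V x}" "closed {x\<in>F. p V x \<le> t i - \<kappa>}" for V
        by (intro continuous_closed_preimage_constant continuous_on_closed_Collect_le
             p_cont continuous_on_const compact_imp_closed F)+
      have "A = F \<inter> (\<Inter>V\<in>S. {x\<in>F. t i + \<kappa> \<le> p V x}) \<inter> (\<Inter>V\<in>\<V>-S. {x\<in>F. p V x \<le> t i - \<kappa>})"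
        unfolding S Z_def by auto
      moreover have "closed (F \<inter> (\<Inter>V\<in>S. {x\<in>F. t i + \<kappa> \<le> p V x}) \<inter> (\<Inter>V\<in>\<V>-S. {x\<in>F. p V x \<le> t i - \<kappa>}))"
        by (intro closed_Int closed_INT ballI 1 compact_imp_closed F)
      ultimately show ?thesis by auto
    qed
    show "dist x y < \<delta>" if "A \<in> \<W> i" "x \<in> A" "y \<in> A" for A i x y
    proof -
      obtain S V where S: "A = Z i S" "S \<subseteq> \<V>" "V \<in> S" using \<open>A \<in> \<W> i\<close> unfolding \<W>_def by blast
      have "z \<in> V" if "z \<in> A" for z
      proof -
        have "z \<in> F" "t i + \<kappa> \<le> p V z" using that S by (auto simp: Z_def)
        then show ?thesis using p_pos[of V z] S t_lower[of i] \<kappa> by fastforce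
      qed
      then show ?thesis using small \<V>(3) S that by (metis subsetD)
    qed
    show "pairwise disjnt (\<W> i)" for i
    proof (clarsimp simp: pairwise_def \<W>_def disjnt_iff)
      fix S T x assume "Z i S \<noteq> Z i T" "S \<subseteq> \<V>" "T \<subseteq> \<V>" and x: "x \<in> Z i S" "x \<in> Z i T"
      then have "S \<noteq> T" by auto
      then obtain V where "V \<in> \<V>" "V \<in> S \<and> V \<in> \<V> - T \<or> V \<in> T \<and> V \<in> \<V> - S"
        using \<open>S \<subseteq> \<V>\<close> \<open>T \<subseteq> \<V>\<close> by blast
      then have "t i + \<kappa> \<le> p V x \<and> p V x \<le> t i - \<kappa>" using x unfolding Z_def by blast
      then show False using \<kappa> by linarith
    qed
    show "card {i. i < N \<and> x \<notin> \<Union>(\<W> i)} \<le> n" if x: "x \<in> F" for x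
    proof -
      let ?B = "{i. i < N \<and> x \<notin> \<Union>(\<W> i)}"
      obtain V0 where V0: "V0 \<in> \<V>" "p V0 x \<ge> c" using large[OF x] by blast
      have "\<exists>V\<in>\<V>. \<bar>p V x - t i\<bar> < \<kappa>" if "i \<in> ?B" for i
      proof (rule ccontr)
        assume no: "\<not> ?thesis"
        define S where "S = {V\<in>\<V>. t i + \<kappa> \<le> p V x}"
        have "V0 \<in> S" using V0 t_upper[of i] that by (auto simp: S_def)
        have "p V x \<le> t i - \<kappa>" if "V \<in> \<V> - S" for V
          using no that by (auto simp: S_def abs_less_iff not_less not_le)
        then have "x \<in> Z i S" using x by (auto simp: Z_def S_def)
        moreover have "Z i S \<in> \<W> i" using \<open>V0 \<in> S\<close> by (auto simp: \<W>_def S_def)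
        ultimately show False using that by blast
      qed
      then obtain v where v: "\<And>i. i \<in> ?B \<Longrightarrow> v i \<in> \<V> \<and> \<bar>p (v i) x - t i\<bar> < \<kappa>" by metis
      \<comment> \<open>A value near two thresholds is impossible, and \<open>p V0 x\<close> is near none.\<close>
      have "inj_on v ?B" by (rule inj_onI) (metis t_sep v)
      moreover have "v ` ?B \<subseteq> {V\<in>\<V>. x \<in> V} - {V0}"
      proof clarify
        fix i assume i: "i < N" "x \<notin> \<Union>(\<W> i)"
        then have *: "v i \<in> \<V>" "\<bar>p (v i) x - t i\<bar> < \<kappa>" using v by auto
        then have "p (v i) x > 0" "p (v i) x < c" using t_lower[of i] t_upper[OF i(1)] by linarith+
        then show "v i \<in> {V\<in>\<V>. x \<in> V} - {V0}" using * p_pos[OF _ x] V0 by auto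
      qed
      moreover have "card ({V\<in>\<V>. x \<in> V} - {V0}) \<le> n"
      proof -
        have "x \<in> V0" using p_pos[OF V0(1) x] V0 c_pos by linarith
        then have "card ({V\<in>\<V>. x \<in> V} - {V0}) = card {V\<in>\<V>. x \<in> V} - 1"
          using V0 by (intro card_Diff_singleton) auto
        then show ?thesis using \<V>(4)[OF x] by linarith
      qed
      moreover have "finite ({V\<in>\<V>. x \<in> V} - {V0})" using \<V>(1) by simp
      ultimately show ?thesis using card_inj_on_le[of v ?B] by (meson order_trans)
    qed
  qed
qed

section \<open>Real functions that separate points at all scales\<close>

lemma continuous_limit_of_error_bounds:
  fixes f :: "nat \<Rightarrow> 'b::topological_space \<Rightarrow> real"
  assumes cont: "\<And>k. continuous_on A (f k)"
    and bound: "\<And>k m x. k \<le> m \<Longrightarrow> x \<in> A \<Longrightarrow> \<bar>f m x - f k x\<bar> \<le> b k"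
    and b: "b \<longlonglongrightarrow> 0"
  obtains g where "continuous_on A g"
    "\<And>k x. x \<in> A \<Longrightarrow> \<bar>g x - f k x\<bar> \<le> b k"
    "\<And>x. x \<in> A \<Longrightarrow> (\<lambda>k. f k x) \<longlonglongrightarrow> g x"
proof -
  have small: "\<exists>K. \<forall>k\<ge>K. b k < e" if "e > 0" for e :: real
    using order_tendstoD(2)[OF b that] by (simp add: eventually_sequentially)
  have "\<exists>l. (\<lambda>k. f k x) \<longlonglongrightarrow> l" if x: "x \<in> A" for x
  proof -
    have "Cauchy (\<lambda>k. f k x)"
      unfolding Cauchy_altdef
    proof (intro allI impI)
      fix e :: real assume "e > 0"
      from small[OF this] obtain K where K: "\<forall>k\<ge>K. b k < e" by blast
      show "\<exists>M. \<forall>m\<ge>M. \<forall>n>m. dist (f m x) (f n x) < e"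
      proof (intro exI[of _ K] allI impI)
        fix m n assume "K \<le> m" "m < n"
        then show "dist (f m x) (f n x) < e"
          using bound[of m n x] K x by (force simp: dist_real_def abs_minus_commute)
      qed
    qed
    then show ?thesis using real_Cauchy_convergent convergent_def by blast
  qed
  then obtain g where g: "\<And>x. x \<in> A \<Longrightarrow> (\<lambda>k. f k x) \<longlonglongrightarrow> g x" by metis
  have le: "\<bar>g x - f k x\<bar> \<le> b k" if "x \<in> A" for k x
  proof (rule tendsto_upperbound)
    show "(\<lambda>m. \<bar>f m x - f k x\<bar>) \<longlonglongrightarrow> \<bar>g x - f k x\<bar>"
      by (intro tendsto_intros g that)
    show "\<forall>\<^sub>F m in sequentially. \<bar>f m x - f k x\<bar> \<le> b k"
      unfolding eventually_sequentially using bound that by blast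
  qed simp
  have "uniform_limit A f g sequentially"
    unfolding uniform_limit_iff
  proof (intro allI impI)
    fix e :: real assume "e > 0"
    from small[OF this] obtain K where K: "\<forall>k\<ge>K. b k < e" by blast
    have "dist (f k x) (g x) < e" if "k \<ge> K" "x \<in> A" for k x
      using K le[of x k] that by (force simp: dist_real_def abs_minus_commute)
    then show "\<forall>\<^sub>F k in sequentially. \<forall>x\<in>A. dist (f k x) (g x) < e"
      unfolding eventually_sequentially by blast
  qed
  then have "continuous_on A g"
    by (rule uniform_limit_theorem[rotated]) (auto simp: cont)
  then show ?thesis using that le g by blast
qed

text \<open>The perturbed function is constant on each member of \<open>\<V>\<close>. Its value there is obtained by
rounding \<open>\<psi>\<close> down to a multiple of \<open>\<eta>/2\<close> and adding a fraction of \<open>\<eta>/2\<close> that is different for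
every member: then the values are close to \<open>\<psi>\<close> and pairwise distinct, because both the multiple and
the fraction can be read off from the sum. Tietze's theorem extends the correction to \<open>F\<close>.\<close>

lemma perturb_to_separate:
  fixes F :: "'b::{metric_space,second_countable_topology} set" and \<psi> :: "'b \<Rightarrow> real"
  assumes \<psi>: "continuous_on F \<psi>" and \<eta>: "\<eta> > 0"
    and \<V>: "finite \<V>" "\<And>V. V \<in> \<V> \<Longrightarrow> closed V \<and> V \<subseteq> F" "pairwise disjnt \<V>"
    and osc: "\<And>V x y. V \<in> \<V> \<Longrightarrow> x \<in> V \<Longrightarrow> y \<in> V \<Longrightarrow> \<bar>\<psi> x - \<psi> y\<bar> \<le> \<eta>/2"
  obtains \<psi>' \<tau> where "continuous_on F \<psi>'" "\<And>x. x \<in> F \<Longrightarrow> \<bar>\<psi>' x - \<psi> x\<bar> \<le> \<eta>" "\<tau> > 0"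
    "\<And>x y. x \<in> \<Union>\<V> \<Longrightarrow> y \<in> \<Union>\<V> \<Longrightarrow> \<bar>\<psi>' x - \<psi>' y\<bar> \<le> \<tau> \<Longrightarrow> \<exists>V\<in>\<V>. x \<in> V \<and> y \<in> V"
proof -
  obtain h where h: "bij_betw h \<V> {0..<card \<V>}"
    using ex_bij_betw_finite_nat[OF \<V>(1)] by blast
  have h_less: "h V < card \<V>" if "V \<in> \<V>" for V using bij_betwE[OF h] that by auto
  define r where "r V = (SOME x. x \<in> V)" for V :: "'b set"
  have r: "r V \<in> V" if "x \<in> V" for x V using that by (auto simp: r_def intro: someI)
  define q where "q V = real (h V) / card \<V>" for V
  have q: "0 \<le> q V" "q V < 1" if "V \<in> \<V>" for V
    using h_less[OF that] by (auto simp: q_def divide_simps)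
  define l where "l V = \<lfloor>\<psi> (r V) / (\<eta>/2)\<rfloor>" for V
  define val where "val V = \<eta>/2 * (l V + q V)" for V
  have inj: "V = V'" if "V \<in> \<V>" "V' \<in> \<V>" "val V = val V'" for V V'
  proof -
    have eq: "l V + q V = l V' + q V'" using that \<eta> by (simp add: val_def)
    then have "\<bar>real_of_int (l V - l V')\<bar> < 1" using q[OF that(1)] q[OF that(2)] by linarith
    then have "l V = l V'" by linarith
    with eq have "q V = q V'" by simp
    then have "h V = h V'" using h_less[OF that(1)] by (auto simp: q_def)
    then show ?thesis using h that by (metis bij_betw_imp_inj_on inj_onD)
  qed
  have near: "\<bar>val V - \<psi> x\<bar> \<le> \<eta>" if "V \<in> \<V>" "x \<in> V" for V x
  proof -
    have "val V - \<psi> (r V) = \<eta>/2 * (l V + q V - \<psi> (r V) / (\<eta>/2))"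
      using \<eta> by (simp add: val_def field_simps)
    then have "\<bar>val V - \<psi> (r V)\<bar> = \<eta>/2 * \<bar>l V + q V - \<psi> (r V) / (\<eta>/2)\<bar>"
      by (simp only: abs_mult) (use \<eta> in simp)
    also have "\<dots> \<le> \<eta>/2 * 1"
    proof (intro mult_left_mono)
      have "l V \<le> \<psi> (r V) / (\<eta>/2)" "\<psi> (r V) / (\<eta>/2) < l V + 1" 
        unfolding l_def using floor_correct[of "\<psi> (r V) / (\<eta>/2)"] by auto
      then show "\<bar>l V + q V - \<psi> (r V) / (\<eta>/2)\<bar> \<le> 1" using q[OF that(1)] unfolding abs_le_iff by linarith
    qed (use \<eta> in simp)
    finally have "\<bar>val V - \<psi> (r V)\<bar> \<le> \<eta>/2" by simp
    moreover have "\<bar>\<psi> (r V) - \<psi> x\<bar> \<le> \<eta>/2" using osc[OF that(1) r[OF that(2)] that(2)] .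
    ultimately show ?thesis by linarith
  qed
  define \<phi> where "\<phi> x = val (SOME V. V \<in> \<V> \<and> x \<in> V)" for x
  have \<phi>: "\<phi> x = val V" if "V \<in> \<V>" "x \<in> V" for x V
  proof -
    have "(SOME V. V \<in> \<V> \<and> x \<in> V) = V"
      using \<V>(3) that by (intro some_equality) (auto simp: pairwise_def disjnt_iff)
    then show ?thesis by (simp add: \<phi>_def)
  qed
  have "continuous_on (\<Union>V\<in>\<V>. V) \<phi>"
  proof (rule continuous_on_closed_Union[OF \<V>(1)])
    show "continuous_on V \<phi>" if "V \<in> \<V>" for V
      by (rule continuous_on_eq[OF continuous_on_const[of V "val V"]]) (simp add: \<phi>[OF that])
  qed (use \<V> in auto)
  then have cont: "continuous_on (\<Union>\<V>) (\<lambda>x. \<phi> x - \<psi> x)"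
    using \<V>(2) by (intro continuous_intros continuous_on_subset[OF \<psi>]) auto
  have "closed (\<Union>\<V>)" using \<V> by (intro closed_Union) auto
  then have cl: "closedin (top_of_set F) (\<Union>\<V>)" using \<V>(2) by (auto intro!: closed_subset)
  have rng: "\<phi> x - \<psi> x \<in> cbox (-\<eta>) \<eta>" if x: "x \<in> \<Union>\<V>" for x
  proof -
    obtain V where "V \<in> \<V>" "x \<in> V" using x by blast
    then show ?thesis using near[of V x] \<phi>[of V x] by auto
  qed
  have "-\<eta> \<le> \<eta>" using \<eta> by simp
  obtain d where d: "continuous_on F d" "\<And>x. x \<in> \<Union>\<V> \<Longrightarrow> d x = \<phi> x - \<psi> x"
     "\<And>x. x \<in> F \<Longrightarrow> d x \<in> cbox (-\<eta>) \<eta>"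
    using Tietze_closed_interval_1[OF cont cl \<open>-\<eta> \<le> \<eta>\<close> rng] by blast
  define D where "D = (\<lambda>(V, V'). \<bar>val V - val V'\<bar>) ` {(V, V'). V \<in> \<V> \<and> V' \<in> \<V> \<and> V \<noteq> V'}"
  have "finite D" unfolding D_def
    by (rule finite_imageI, rule finite_subset[of _ "\<V> \<times> \<V>"]) (use \<V>(1) in auto)
  have "\<forall>z\<in>D. z > 0" unfolding D_def using inj by auto
  define m where "m = Min (insert 1 D)"
  have pos: "m > 0" using \<open>\<forall>z\<in>D. z > 0\<close> \<open>finite D\<close> by (auto simp: m_def)
  have m_le: "m \<le> z" if "z \<in> D" for z using that \<open>finite D\<close> by (auto simp: m_def)
  show ?thesis
  proof (rule that[of "\<lambda>x. \<psi> x + d x" "m / 2"])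
    show "continuous_on F (\<lambda>x. \<psi> x + d x)" by (intro continuous_intros \<psi> d)
    show "\<bar>\<psi> x + d x - \<psi> x\<bar> \<le> \<eta>" if "x \<in> F" for x using d(3)[OF that] by auto
    show "m / 2 > 0" using pos by simp
    fix x y assume xy: "x \<in> \<Union>\<V>" "y \<in> \<Union>\<V>" "\<bar>\<psi> x + d x - (\<psi> y + d y)\<bar> \<le> m / 2"
    from xy(1,2) obtain V V' where V: "V \<in> \<V>" "x \<in> V" "V' \<in> \<V>" "y \<in> V'" by auto
    have "V = V'"
    proof (rule ccontr)
      assume "V \<noteq> V'"
      then have "\<bar>val V - val V'\<bar> \<in> D" unfolding D_def using V by force
      then have le: "m \<le> \<bar>val V - val V'\<bar>" by (rule m_le)
      have eq: "\<psi> x + d x = val V" using d(2)[OF xy(1)] \<phi>[OF V(1,2)] by simp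
      have eq': "\<psi> y + d y = val V'" using d(2)[OF xy(2)] \<phi>[OF V(3,4)] by simp
      have "\<bar>val V - val V'\<bar> \<le> m / 2" using xy(3) unfolding eq eq' .
      with le pos show False by simp
    qed
    then show "\<exists>V\<in>\<V>. x \<in> V \<and> y \<in> V" using V by (intro bexI[of _ V]) auto
  qed
qed

text \<open>The margin \<open>\<tau>\<close> makes the property stable under small perturbations of \<open>\<psi>\<close>. The sets \<open>W i\<close> may miss
points because a single real function cannot, in general, separate points everywhere; for \<open>N = 2 * n + 1\<close> the sets that contain a given
point are still in the majority.\<close>

definition jointly_separates :: "'b::metric_space set \<Rightarrow> nat \<Rightarrow> nat \<Rightarrow> real \<Rightarrow> real \<Rightarrow> (nat \<Rightarrow> 'b \<Rightarrow> real) \<Rightarrow> bool"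
  where "jointly_separates F n N \<delta> \<tau> \<psi> \<longleftrightarrow>
    (\<exists>W. (\<forall>i<N. W i \<subseteq> F \<and> (\<forall>x\<in>W i. \<forall>y\<in>W i. \<bar>\<psi> i x - \<psi> i y\<bar> \<le> \<tau> \<longrightarrow> dist x y < \<delta>)) \<and>
         (\<forall>x\<in>F. card {i. i < N \<and> x \<notin> W i} \<le> n))"

lemma jointly_separates_mono:
  assumes "\<tau>' \<le> \<tau>" "jointly_separates F n N \<delta> \<tau> \<psi>"
  shows "jointly_separates F n N \<delta> \<tau>' \<psi>"
  using assms(2) unfolding jointly_separates_def
  by (rule ex_forward) (use assms(1) in \<open>force intro: order_trans\<close>)

text \<open>Each \<open>\<psi> i\<close> is perturbed so that it separates the \<open>i\<close>-th of the disjoint families of sets; these are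
taken so small that \<open>\<psi> i\<close> hardly varies on any of them.\<close>

lemma perturb_to_jointly_separate:
  fixes F :: "'b::{metric_space,second_countable_topology} set"
  assumes F: "compact F" and dim: "covering_dim_le (top_of_set F) n"
    and \<psi>: "\<And>i. i < N \<Longrightarrow> continuous_on F (\<psi> i)" and \<eta>: "\<eta> > 0" and \<delta>: "\<delta> > 0"
  obtains \<psi>' \<tau> where "\<And>i. i < N \<Longrightarrow> continuous_on F (\<psi>' i)"
    "\<And>i x. i < N \<Longrightarrow> x \<in> F \<Longrightarrow> \<bar>\<psi>' i x - \<psi> i x\<bar> \<le> \<eta>" "\<tau> > 0" "jointly_separates F n N \<delta> \<tau> \<psi>'"
proof -
  have "\<exists>d>0. \<forall>x\<in>F. \<forall>y\<in>F. dist x y < d \<longrightarrow> \<bar>\<psi> i x - \<psi> i y\<bar> \<le> \<eta>/2" if "i < N" for i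
  proof -
    have "uniformly_continuous_on F (\<psi> i)" using compact_uniformly_continuous[OF \<psi> F] that by blast
    then have "\<exists>d>0. \<forall>x\<in>F. \<forall>x'\<in>F. dist x' x < d \<longrightarrow> dist (\<psi> i x') (\<psi> i x) < \<eta>/2"
      unfolding uniformly_continuous_on_def using \<eta> half_gt_zero by blast
    then show ?thesis by (metis dist_real_def less_imp_le)
  qed
  then obtain d where d: "\<And>i. i < N \<Longrightarrow> d i > 0"
    "\<And>i x y. i < N \<Longrightarrow> x \<in> F \<Longrightarrow> y \<in> F \<Longrightarrow> dist x y < d i \<Longrightarrow> \<bar>\<psi> i x - \<psi> i y\<bar> \<le> \<eta>/2"
    by metis
  define \<delta>' where "\<delta>' = Min (insert \<delta> (d ` {..<N}))"
  have \<delta>': "\<delta>' > 0" "\<delta>' \<le> \<delta>" "\<And>i. i < N \<Longrightarrow> \<delta>' \<le> d i"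
    unfolding \<delta>'_def using d \<delta> by auto
  obtain \<W> where \<W>: "\<And>i. finite (\<W> i)"
    "\<And>i Z. Z \<in> \<W> i \<Longrightarrow> closed Z \<and> Z \<subseteq> F"
    "\<And>i Z x y. Z \<in> \<W> i \<Longrightarrow> x \<in> Z \<Longrightarrow> y \<in> Z \<Longrightarrow> dist x y < \<delta>'"
    "\<And>i. pairwise disjnt (\<W> i)"
    "\<And>x. x \<in> F \<Longrightarrow> card {i. i < N \<and> x \<notin> \<Union>(\<W> i)} \<le> n"
    using disjoint_small_families[OF F dim \<delta>'(1), where N = N] by blast
  have "\<exists>\<phi> \<tau>. continuous_on F \<phi> \<and> (\<forall>x\<in>F. \<bar>\<phi> x - \<psi> i x\<bar> \<le> \<eta>) \<and> \<tau> > 0 \<and>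
     (\<forall>x\<in>\<Union>(\<W> i). \<forall>y\<in>\<Union>(\<W> i). \<bar>\<phi> x - \<phi> y\<bar> \<le> \<tau> \<longrightarrow> dist x y < \<delta>)" if i: "i < N" for i
  proof -
    have osc: "\<bar>\<psi> i x - \<psi> i y\<bar> \<le> \<eta>/2" if "Z \<in> \<W> i" "x \<in> Z" "y \<in> Z" for Z x y
    proof (rule d(2)[OF i])
      show "x \<in> F" "y \<in> F" using \<W>(2)[OF that(1)] that by auto
      show "dist x y < d i" using \<W>(3)[OF that] \<delta>'(3)[OF i] by linarith
    qed
    obtain \<phi> \<tau> where \<phi>: "continuous_on F \<phi>" "\<And>x. x \<in> F \<Longrightarrow> \<bar>\<phi> x - \<psi> i x\<bar> \<le> \<eta>" "\<tau> > 0"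
      "\<And>x y. x \<in> \<Union>(\<W> i) \<Longrightarrow> y \<in> \<Union>(\<W> i) \<Longrightarrow> \<bar>\<phi> x - \<phi> y\<bar> \<le> \<tau> \<Longrightarrow> \<exists>V\<in>\<W> i. x \<in> V \<and> y \<in> V"
      by (rule perturb_to_separate[OF \<psi>[OF i] \<eta> \<W>(1)[of i] \<W>(2)[of _ i] \<W>(4)[of i] osc], (assumption | rule that)+)
    have "dist x y < \<delta>" if xy: "x \<in> \<Union>(\<W> i)" "y \<in> \<Union>(\<W> i)" "\<bar>\<phi> x - \<phi> y\<bar> \<le> \<tau>" for x y
    proof -
      obtain V where "V \<in> \<W> i" "x \<in> V" "y \<in> V" using \<phi>(4)[OF xy] by blast
      from \<W>(3)[OF this] show ?thesis using \<delta>'(2) by linarith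
    qed
    with \<phi> show ?thesis by blast
  qed
  then obtain \<phi> \<tau> where \<phi>: "\<And>i. i < N \<Longrightarrow> continuous_on F (\<phi> i) \<and> (\<forall>x\<in>F. \<bar>\<phi> i x - \<psi> i x\<bar> \<le> \<eta>) \<and> \<tau> i > 0 \<and>
     (\<forall>x\<in>\<Union>(\<W> i). \<forall>y\<in>\<Union>(\<W> i). \<bar>\<phi> i x - \<phi> i y\<bar> \<le> \<tau> i \<longrightarrow> dist x y < \<delta>)"
    by metis
  define t where "t = Min (insert (1::real) (\<tau> ` {..<N}))"
  have t: "t > 0" "\<And>i. i < N \<Longrightarrow> t \<le> \<tau> i" unfolding t_def using \<phi> by auto
  have sep: "jointly_separates F n N \<delta> t \<phi>"
    unfolding jointly_separates_def
  proof (intro exI[of _ "\<lambda>i. \<Union>(\<W> i)"] conjI allI impI ballI)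
    show "\<Union>(\<W> i) \<subseteq> F" for i using \<W>(2) by blast
    show "dist x y < \<delta>" if "i < N" "x \<in> \<Union>(\<W> i)" "y \<in> \<Union>(\<W> i)" "\<bar>\<phi> i x - \<phi> i y\<bar> \<le> t" for i x y
    proof -
      have "\<bar>\<phi> i x - \<phi> i y\<bar> \<le> \<tau> i" using t(2)[OF that(1)] that(4) by linarith
      then show ?thesis using \<phi>[OF that(1)] that(2,3) by blast
    qed
  qed (use \<W>(5) in auto)
  have "continuous_on F (\<phi> i)" if "i < N" for i
    using \<phi>[OF that] by blast
  moreover have "\<bar>\<phi> i x - \<psi> i x\<bar> \<le> \<eta>" if "i < N" "x \<in> F" for i x
    using \<phi>[OF that(1)] that(2) by blast
  ultimately show ?thesis by (rule that[OF _ _ t(1) sep])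
qed

text \<open>One cannot expect a single real-valued function to be injective on a set of higher dimension,
but a limit of perturbations can separate points at every scale on suitable sets depending on the
scale. The tolerances \<open>\<eta>\<close> are
halved from step to step and chosen small compared with the margins already achieved, so that later
perturbations do not destroy them.\<close>

lemma jointly_separating_functions:
  fixes F :: "'b::{metric_space,second_countable_topology} set"
  assumes F: "compact F" and dim: "covering_dim_le (top_of_set F) n"
  obtains \<psi> where "\<And>i. i < N \<Longrightarrow> continuous_on F (\<psi> i)" "\<And>i x. i < N \<Longrightarrow> x \<in> F \<Longrightarrow> \<psi> i x \<in> {0..1::real}"
    "\<And>\<delta>. \<delta> > 0 \<Longrightarrow> \<exists>\<tau>>0. jointly_separates F n N \<delta> \<tau> \<psi>"
proof -
  define P where "P = (\<lambda>(k::nat) (\<psi>::nat \<Rightarrow> 'b \<Rightarrow> real, \<eta>::real).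
    (\<forall>i<N. continuous_on F (\<psi> i)) \<and> \<eta> > 0 \<and> (k = 0 \<longrightarrow> \<psi> = (\<lambda>i x. 1/2) \<and> \<eta> = 1/4))"
  define Q where "Q = (\<lambda>(k::nat) (\<psi>::nat \<Rightarrow> 'b \<Rightarrow> real, \<eta>::real) (\<psi>'::nat \<Rightarrow> 'b \<Rightarrow> real, \<eta>'::real).
    (\<forall>i<N. \<forall>x\<in>F. \<bar>\<psi>' i x - \<psi> i x\<bar> \<le> \<eta>) \<and> \<eta>' \<le> \<eta>/2 \<and> jointly_separates F n N (1 / Suc k) (6 * \<eta>') \<psi>')"
  have "\<exists>s. \<forall>k. P k (s k) \<and> Q k (s k) (s (Suc k))"
  proof (rule dependent_nat_choice)
    show "\<exists>s. P 0 s" by (intro exI[of _ "(\<lambda>i x. 1/2, 1/4)"]) (simp add: P_def)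
    fix s k assume "P k s"
    then obtain \<psi> \<eta> where s: "s = (\<psi>, \<eta>)" and *: "\<And>i. i < N \<Longrightarrow> continuous_on F (\<psi> i)" "\<eta> > 0"
      by (cases s) (auto simp: P_def)
    obtain \<psi>' \<tau> where \<psi>': "\<And>i. i < N \<Longrightarrow> continuous_on F (\<psi>' i)"
      "\<And>i x. i < N \<Longrightarrow> x \<in> F \<Longrightarrow> \<bar>\<psi>' i x - \<psi> i x\<bar> \<le> \<eta>" "\<tau> > 0" "jointly_separates F n N (1 / Suc k) \<tau> \<psi>'"
      using perturb_to_jointly_separate[where \<psi> = \<psi> and N = N and \<delta> = "1 / real (Suc k)", OF F dim *(1) *(2)]
      by (metis of_nat_0_less_iff zero_less_Suc zero_less_divide_1_iff)
    \<comment> \<open>All later perturbations together move a function by at most twice the tolerance, hence a difference of two values by at most four times; margin six leaves two for the limit.\<close>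
    have "jointly_separates F n N (1 / Suc k) (6 * min (\<eta>/2) (\<tau>/6)) \<psi>'"
    proof -
      have "6 * min (\<eta>/2) (\<tau>/6) \<le> \<tau>" by linarith
      then show ?thesis using \<psi>'(4) by (rule jointly_separates_mono)
    qed
    then show "\<exists>s'. P (Suc k) s' \<and> Q k s s'"
      using \<psi>' * by (intro exI[of _ "(\<psi>', min (\<eta>/2) (\<tau>/6))"]) (auto simp: P_def Q_def s)
  qed
  then obtain s where s: "\<And>k. P k (s k)" "\<And>k. Q k (s k) (s (Suc k))" by blast
  define \<psi> where "\<psi> k = fst (s k)" for k
  define \<eta> where "\<eta> k = snd (s k)" for k
  have cont: "\<And>k i. i < N \<Longrightarrow> continuous_on F (\<psi> k i)" and \<eta>_pos: "\<And>k. \<eta> k > 0"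
    and init: "\<psi> 0 = (\<lambda>i x. 1/2)" "\<eta> 0 = 1/4"
    using s(1) unfolding P_def \<psi>_def \<eta>_def by (auto simp: case_prod_beta)
  have step_le: "\<And>k i x. i < N \<Longrightarrow> x \<in> F \<Longrightarrow> \<bar>\<psi> (Suc k) i x - \<psi> k i x\<bar> \<le> \<eta> k"
    and half: "\<And>k. \<eta> (Suc k) \<le> \<eta> k / 2"
    and sep: "\<And>k. jointly_separates F n N (1 / Suc k) (6 * \<eta> (Suc k)) (\<psi> (Suc k))"
    using s(2) unfolding Q_def \<psi>_def \<eta>_def by (auto simp: case_prod_beta)
  have tail: "\<bar>\<psi> m i x - \<psi> k i x\<bar> \<le> 2 * \<eta> k" if "k \<le> m" "i < N" "x \<in> F" for k m i x
  proof -
    \<comment> \<open>The telescoping form of the bound is what makes the induction work.\<close>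
    have "\<bar>\<psi> m i x - \<psi> k i x\<bar> \<le> 2 * \<eta> k - 2 * \<eta> m" using \<open>k \<le> m\<close>
    proof (induction m rule: dec_induct)
      case (step m)
      then show ?case using step_le[OF that(2,3), of m] half[of m] by linarith
    qed simp
    then show ?thesis using \<eta>_pos[of m] by linarith
  qed
  have "\<eta> k \<le> (1/2)^k" for k
  proof (induction k)
    case (Suc k) then show ?case using half[of k] by simp
  qed (simp add: init)
  then have "(\<lambda>k. 2 * \<eta> k) \<longlonglongrightarrow> 0"
  proof -
    have "\<eta> \<longlonglongrightarrow> 0"
      by (rule tendsto_sandwich[OF _ _ tendsto_const LIMSEQ_power_zero[of "1/2::real"]])
        (use \<open>\<And>k. \<eta> k \<le> (1/2)^k\<close> \<eta>_pos in \<open>auto intro: less_imp_le always_eventually\<close>)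
    then show ?thesis by (rule tendsto_mult_right_zero)
  qed
  then have "\<exists>g. continuous_on F g \<and> (\<forall>k. \<forall>x\<in>F. \<bar>g x - \<psi> k i x\<bar> \<le> 2 * \<eta> k)" if i: "i < N" for i
    by (rule continuous_limit_of_error_bounds[of F "\<lambda>k. \<psi> k i" "\<lambda>k. 2 * \<eta> k", rotated 2])
      (use cont[OF i] tail i in auto)
  then obtain \<phi> where \<phi>: "\<And>i. i < N \<Longrightarrow> continuous_on F (\<phi> i)"
    "\<And>i k x. i < N \<Longrightarrow> x \<in> F \<Longrightarrow> \<bar>\<phi> i x - \<psi> k i x\<bar> \<le> 2 * \<eta> k" by metis
  show ?thesis
  proof (rule that[of \<phi>])
    \<comment> \<open>The construction starts at the constant 1/2 with tolerance 1/4.\<close>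
    show "\<phi> i x \<in> {0..1}" if "i < N" "x \<in> F" for i x
    proof -
      have "\<bar>\<phi> i x - 1/2\<bar> \<le> 1/2" using \<phi>(2)[OF that, of 0] by (simp add: init)
      then have "0 \<le> \<phi> i x" "\<phi> i x \<le> 1" by linarith+
      then show ?thesis by simp
    qed
    show "\<exists>\<tau>>0. jointly_separates F n N \<delta> \<tau> \<phi>" if \<delta>: "\<delta> > 0" for \<delta>
    proof -
      obtain k where k: "1 / Suc k < \<delta>" using nat_approx_posE[OF \<delta>] by metis
      obtain W where W: "\<forall>i<N. W i \<subseteq> F \<and> (\<forall>x\<in>W i. \<forall>y\<in>W i.
          \<bar>\<psi> (Suc k) i x - \<psi> (Suc k) i y\<bar> \<le> 6 * \<eta> (Suc k) \<longrightarrow> dist x y < 1 / real (Suc k))"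
        and card: "\<forall>x\<in>F. card {i. i < N \<and> x \<notin> W i} \<le> n"
        using sep[of k] unfolding jointly_separates_def by (elim exE conjE) (rule that)
      have "dist x y < \<delta>" if *: "i < N" "x \<in> W i" "y \<in> W i" "\<bar>\<phi> i x - \<phi> i y\<bar> \<le> 2 * \<eta> (Suc k)" for i x y
      proof -
        have "x \<in> F" "y \<in> F" using W * by auto
        then have "\<bar>\<psi> (Suc k) i x - \<psi> (Suc k) i y\<bar> \<le> 6 * \<eta> (Suc k)"
          using \<phi>(2)[OF *(1), of x "Suc k"] \<phi>(2)[OF *(1), of y "Suc k"] *(4) by linarith
        then show ?thesis using W * k by fastforce
      qed
      then have "jointly_separates F n N \<delta> (2 * \<eta> (Suc k)) \<phi>"
        unfolding jointly_separates_def using W card by (intro exI[of _ W]) auto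
      then show ?thesis using \<eta>_pos[of "Suc k"] by (intro exI[of _ "2 * \<eta> (Suc k)"]) auto
    qed
  qed (use \<phi> in auto)
qed

section \<open>Superpositions of functions of one variable\<close>

text \<open>On \<open>W\<close> the function \<open>h\<close> is almost a function of \<open>\<psi>\<close>. The infimum of \<open>h x + L * \<bar>\<psi> x - s\<bar>\<close> over
\<open>x\<close> (McShane's formula for extending Lipschitz functions) makes it one: with \<open>L * \<tau> = 2 * B\<close> the penalty
outweighs any gain from points where \<open>\<psi>\<close> differs by more than \<open>\<tau>\<close> from \<open>s\<close>.\<close>

lemma approximate_factorisation:
  fixes \<psi> h :: "'b \<Rightarrow> real"
  assumes \<tau>: "\<tau> > 0" and B: "B \<ge> 0" and hB: "\<And>x. x \<in> W \<Longrightarrow> \<bar>h x\<bar> \<le> B"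
    and osc: "\<And>x y. x \<in> W \<Longrightarrow> y \<in> W \<Longrightarrow> \<bar>\<psi> x - \<psi> y\<bar> \<le> \<tau> \<Longrightarrow> \<bar>h x - h y\<bar> \<le> \<epsilon>"
  shows "\<exists>g. continuous_on UNIV g \<and> (\<forall>s. \<bar>g s\<bar> \<le> B) \<and> (\<forall>x\<in>W. \<bar>g (\<psi> x) - h x\<bar> \<le> \<epsilon>)"
proof (cases "W = {}")
  case True
  then show ?thesis using B by (intro exI[of _ "\<lambda>_. 0"]) auto
next
  case False
  define L where "L = 2 * B / \<tau>"
  have L: "L \<ge> 0" "L * \<tau> = 2 * B" using \<tau> B by (auto simp: L_def)
  define g where "g s = (INF x\<in>W. h x + L * \<bar>\<psi> x - s\<bar>)" for s
  have "- B \<le> h x + L * \<bar>\<psi> x - s\<bar>" if "x \<in> W" for x s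
  proof -
    have "0 \<le> L * \<bar>\<psi> x - s\<bar>" using L by simp
    then show ?thesis using hB[OF that] by linarith
  qed
  then have bdd: "bdd_below ((\<lambda>x. h x + L * \<bar>\<psi> x - s\<bar>) ` W)" for s
    by (intro bdd_belowI2)
  have lower: "g s \<le> h x + L * \<bar>\<psi> x - s\<bar>" if "x \<in> W" for x s
    unfolding g_def by (rule cINF_lower[OF bdd that])
  have lip: "g s - L * \<bar>s - t\<bar> \<le> g t" for s t
  proof -
    have "g s - L * \<bar>s - t\<bar> \<le> h x + L * \<bar>\<psi> x - t\<bar>" if "x \<in> W" for x
    proof -
      have "L * \<bar>\<psi> x - s\<bar> \<le> L * (\<bar>\<psi> x - t\<bar> + \<bar>s - t\<bar>)" using L by (intro mult_left_mono) auto
      then show ?thesis using lower[OF that, of s] by (simp add: distrib_left)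
    qed
    then show ?thesis unfolding g_def[of t] by (intro cINF_greatest[OF False])
  qed
  have "L-lipschitz_on UNIV g"
  proof (rule lipschitz_onI)
    show "dist (g s) (g t) \<le> L * dist s t" for s t
      using lip[of s t] lip[of t s] by (simp add: dist_real_def abs_le_iff abs_minus_commute)
  qed (use L in simp)
  then have cont: "continuous_on UNIV g" by (rule lipschitz_on_continuous_on)
  have near: "h y - \<epsilon> \<le> g (\<psi> y)" if y: "y \<in> W" for y
    unfolding g_def
  proof (rule cINF_greatest[OF False])
    fix x assume x: "x \<in> W"
    show "h y - \<epsilon> \<le> h x + L * \<bar>\<psi> x - \<psi> y\<bar>"
    proof (cases "\<bar>\<psi> x - \<psi> y\<bar> \<le> \<tau>")
      case True
      moreover have "0 \<le> L * \<bar>\<psi> x - \<psi> y\<bar>" using L by simp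
      ultimately show ?thesis using osc[OF x y] by linarith
    next
      case False
      then have "L * \<tau> \<le> L * \<bar>\<psi> x - \<psi> y\<bar>" using L by (intro mult_left_mono) auto
      moreover have "0 \<le> \<epsilon>" using osc[OF y y] \<tau> by simp
      ultimately show ?thesis using hB[OF x] hB[OF y] L(2) by linarith
    qed
  qed
  show ?thesis
  proof (intro exI[of _ "\<lambda>s. max (- B) (min B (g s))"] conjI allI ballI)
    show "continuous_on UNIV (\<lambda>s. max (- B) (min B (g s)))" by (intro continuous_intros cont)
    show "\<bar>max (- B) (min B (g s))\<bar> \<le> B" for s using B by linarith
    show "\<bar>max (- B) (min B (g (\<psi> x))) - h x\<bar> \<le> \<epsilon>" if "x \<in> W" for x
      using near[OF that] lower[OF that, of "\<psi> x"] hB[OF that] by simp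
  qed
qed

text \<open>At every point at least \<open>n + 1\<close> of the \<open>2 * n + 1\<close> summands are good, that is, close to \<open>h / (n + 1)\<close>,
and \<open>n + 1\<close> of these add up to \<open>h\<close>. The remaining \<open>n\<close> summands are bounded by \<open>B / (n + 1)\<close> each, which
leaves an error of at most \<open>n / (n + 1) * B\<close>, up to an arbitrarily small amount. That the error is a fixed
fraction of \<open>B\<close>, smaller than \<open>B\<close>, is what allows iteration.\<close>

lemma approximate_superposition:
  fixes F :: "'b::metric_space set" and h :: "'b \<Rightarrow> real"
  assumes F: "compact F"
    and sep: "\<And>\<delta>. \<delta> > 0 \<Longrightarrow> \<exists>\<tau>>0. jointly_separates F n (2*n+1) \<delta> \<tau> \<psi>"
    and h: "continuous_on F h" and hB: "\<And>x. x \<in> F \<Longrightarrow> \<bar>h x\<bar> \<le> B" and B: "B > 0"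
  shows "\<exists>g. (\<forall>i. continuous_on UNIV (g i)) \<and> (\<forall>i s. \<bar>g i s\<bar> \<le> B / (real n + 1)) \<and>
    (\<forall>x\<in>F. \<bar>h x - (\<Sum>i<2*n+1. g i (\<psi> i x))\<bar> \<le> (1 - 1 / (2 * (real n + 1))) * B)"
proof -
  define w where "w = 1 / (real n + 1)"
  have w: "w > 0" "(real n + 1) * w = 1" by (auto simp: w_def)
  have \<epsilon>: "B * w / 2 > 0" using B w by simp
  obtain \<delta> where \<delta>: "\<delta> > 0" "\<And>x y. x \<in> F \<Longrightarrow> y \<in> F \<Longrightarrow> dist x y < \<delta> \<Longrightarrow> \<bar>h x - h y\<bar> < B * w / 2"
  proof -
    have "uniformly_continuous_on F h" by (rule compact_uniformly_continuous[OF h F])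
    then show ?thesis using \<epsilon> that unfolding uniformly_continuous_on_def dist_real_def by metis
  qed
  obtain \<tau> where \<tau>: "\<tau> > 0" "jointly_separates F n (2*n+1) \<delta> \<tau> \<psi>" using sep[OF \<delta>(1)] by blast
  obtain W where W: "\<forall>i<2*n+1. W i \<subseteq> F \<and> (\<forall>x\<in>W i. \<forall>y\<in>W i. \<bar>\<psi> i x - \<psi> i y\<bar> \<le> \<tau> \<longrightarrow> dist x y < \<delta>)"
    and card: "\<forall>x\<in>F. card {i. i < 2*n+1 \<and> x \<notin> W i} \<le> n"
    using \<tau>(2) unfolding jointly_separates_def by (elim exE conjE) (rule that)
  have "\<exists>g. continuous_on UNIV g \<and> (\<forall>s. \<bar>g s\<bar> \<le> w * B) \<and> (\<forall>x\<in>W i. \<bar>g (\<psi> i x) - w * h x\<bar> \<le> w * (B * w / 2))"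
    if i: "i < 2*n+1" for i
  proof (rule approximate_factorisation[OF \<tau>(1)])
    show "\<bar>w * h x\<bar> \<le> w * B" if "x \<in> W i" for x
      using W i that hB[of x] w by (auto simp: abs_mult)
    show "\<bar>w * h x - w * h y\<bar> \<le> w * (B * w / 2)" if "x \<in> W i" "y \<in> W i" "\<bar>\<psi> i x - \<psi> i y\<bar> \<le> \<tau>" for x y
    proof -
      have "x \<in> F" "y \<in> F" "dist x y < \<delta>" using W i that by auto
      then have "w * \<bar>h x - h y\<bar> \<le> w * (B * w / 2)" using \<delta>(2)[of x y] w by (intro mult_left_mono) auto
      then show ?thesis using w by (simp add: abs_mult flip: right_diff_distrib)
    qed
  qed (use w B in simp)
  then have "\<forall>i. \<exists>g. continuous_on UNIV g \<and> (\<forall>s. \<bar>g s\<bar> \<le> w * B) \<and>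
      (i < 2*n+1 \<longrightarrow> (\<forall>x\<in>W i. \<bar>g (\<psi> i x) - w * h x\<bar> \<le> w * (B * w / 2)))"
    using w B by (metis abs_zero continuous_on_const mult_nonneg_nonneg less_imp_le)
  then obtain g where g: "\<And>i. continuous_on UNIV (g i)" "\<And>i s. \<bar>g i s\<bar> \<le> w * B"
    "\<And>i x. i < 2*n+1 \<Longrightarrow> x \<in> W i \<Longrightarrow> \<bar>g i (\<psi> i x) - w * h x\<bar> \<le> w * (B * w / 2)"
    by metis
  have "\<bar>h x - (\<Sum>i<2*n+1. g i (\<psi> i x))\<bar> \<le> (1 - 1 / (2 * (real n + 1))) * B" if x: "x \<in> F" for x
  proof -
    let ?bad = "{i. i < 2*n+1 \<and> x \<notin> W i}" and ?good = "{i. i < 2*n+1 \<and> x \<in> W i}"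
    have "{..<2*n+1} = ?good \<union> ?bad" by auto
    then have "card {..<2*n+1} = card ?good + card ?bad"
      using card_Un_disjoint[of ?good ?bad] by auto
    then have "n + 1 \<le> card ?good" using card x by auto
    then obtain I where I: "I \<subseteq> ?good" "card I = n + 1" "finite I"
      by (rule obtain_subset_with_card_n)
    let ?R = "{..<2*n+1} - I"
    have cR: "card ?R = n" using I by (subst card_Diff_subset) auto
    have "(\<Sum>i<2*n+1. g i (\<psi> i x)) = (\<Sum>i\<in>I. g i (\<psi> i x)) + (\<Sum>i\<in>?R. g i (\<psi> i x))"
      using I(1) by (subst sum.subset_diff[of I]) auto
    moreover have "h x = (\<Sum>i\<in>I. w * h x)"
    proof -
      have "h x = ((real n + 1) * w) * h x" using w(2) by simp
      also have "\<dots> = (\<Sum>i\<in>I. w * h x)" using I(2) by (simp add: algebra_simps)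
      finally show ?thesis .
    qed
    ultimately have "h x - (\<Sum>i<2*n+1. g i (\<psi> i x)) = (\<Sum>i\<in>I. w * h x - g i (\<psi> i x)) - (\<Sum>i\<in>?R. g i (\<psi> i x))"
      by (simp add: sum_subtractf)
    moreover have "\<bar>\<Sum>i\<in>I. w * h x - g i (\<psi> i x)\<bar> \<le> B * w / 2"
    proof -
      have "\<bar>\<Sum>i\<in>I. w * h x - g i (\<psi> i x)\<bar> \<le> (\<Sum>i\<in>I. w * (B * w / 2))"
        using I(1) g(3)[of _ x] by (intro order_trans[OF sum_abs sum_mono]) (auto simp: abs_minus_commute)
      also have "\<dots> = ((real n + 1) * w) * (B * w / 2)" using I(2) by (simp add: algebra_simps)
      finally show ?thesis using w(2) by simp
    qed
    moreover have "\<bar>\<Sum>i\<in>?R. g i (\<psi> i x)\<bar> \<le> n * (w * B)"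
    proof -
      have "\<bar>\<Sum>i\<in>?R. g i (\<psi> i x)\<bar> \<le> (\<Sum>i\<in>?R. w * B)"
        by (intro order_trans[OF sum_abs sum_mono] g)
      then show ?thesis using cR by simp
    qed
    moreover have "B * w / 2 + n * (w * B) = (1 - 1 / (2 * (real n + 1))) * B"
    proof -
      have "n * w = 1 - w" using w(2) by (simp add: algebra_simps)
      then have 1: "n * (w * B) = (1 - w) * B" by (simp flip: mult.assoc)
      have 2: "1 / (2 * (real n + 1)) = w / 2" by (simp add: w_def)
      show ?thesis unfolding 1 2 by (simp add: algebra_simps)
    qed
    ultimately show ?thesis by linarith
  qed
  then show ?thesis using g by (intro exI[of _ g]) (auto simp: w_def)
qed

text \<open>The approximation is applied again to the error, and so on; errors and summands decrease
geometrically. The sum of the bounds on the summands is \<open>2 * B\<close> for every \<open>n\<close>.\<close>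

lemma superposition_of_separating_functions:
  fixes F :: "'b::metric_space set" and h :: "'b \<Rightarrow> real"
  assumes F: "compact F"
    and \<psi>: "\<And>i. i < 2*n+1 \<Longrightarrow> continuous_on F (\<psi> i)"
    and sep: "\<And>\<delta>. \<delta> > 0 \<Longrightarrow> \<exists>\<tau>>0. jointly_separates F n (2*n+1) \<delta> \<tau> \<psi>"
    and h: "continuous_on F h" and hB: "\<And>x. x \<in> F \<Longrightarrow> \<bar>h x\<bar> \<le> B" and B: "B > 0"
  shows "\<exists>g. (\<forall>i. continuous_on UNIV (g i)) \<and> (\<forall>i s. \<bar>g i s\<bar> \<le> 2 * B) \<and>
    (\<forall>x\<in>F. h x = (\<Sum>i<2*n+1. g i (\<psi> i x)))"
proof -
  define \<theta> where "\<theta> = 1 - 1 / (2 * (real n + 1))"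
  have \<theta>: "0 < \<theta>" "\<theta> < 1" by (auto simp: \<theta>_def field_simps)
  define P where "P k r \<longleftrightarrow> continuous_on F r \<and> (\<forall>x\<in>F. \<bar>r x\<bar> \<le> \<theta>^k * B)" for k :: nat and r
  define A where "A k r g \<longleftrightarrow> (\<forall>i. continuous_on UNIV (g i)) \<and> (\<forall>i s. \<bar>g i s\<bar> \<le> \<theta>^k * B / (real n + 1)) \<and>
    (\<forall>x\<in>F. \<bar>r x - (\<Sum>i<2*n+1. g i (\<psi> i x))\<bar> \<le> \<theta> * (\<theta>^k * B))" for k :: nat and r and g :: "nat \<Rightarrow> real \<Rightarrow> real"
  have "\<exists>g. A k r g" if "P k r" for k r
    unfolding A_def \<theta>_def[symmetric]
    using approximate_superposition[OF F sep, where h = r and B = "\<theta>^k * B"] that \<theta> B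
    unfolding P_def \<theta>_def[symmetric] by simp
  then obtain G where G: "\<And>k r. P k r \<Longrightarrow> A k r (G k r)" by metis
  define r where "r = rec_nat h (\<lambda>k r x. r x - (\<Sum>i<2*n+1. G k r i (\<psi> i x)))"
  have r: "r 0 = h" "\<And>k. r (Suc k) = (\<lambda>x. r k x - (\<Sum>i<2*n+1. G k (r k) i (\<psi> i x)))"
    by (simp_all add: r_def)
  have P: "P k (r k)" for k
  proof (induction k)
    case 0 show ?case using h hB by (simp add: P_def r)
  next
    case (Suc k)
    then have "continuous_on F (r k)" and A: "A k (r k) (G k (r k))" using G by (auto simp: P_def)
    have "continuous_on F (\<lambda>x. G k (r k) i (\<psi> i x))" if "i < 2*n+1" for i
      by (rule continuous_on_compose2[of UNIV "G k (r k) i"]) (use A \<psi>[OF that] in \<open>auto simp: A_def\<close>)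
    then have "continuous_on F (r (Suc k))"
      unfolding r by (intro continuous_on_diff \<open>continuous_on F (r k)\<close> continuous_on_sum) auto
    then show ?case using A unfolding P_def A_def r by (simp add: mult.assoc)
  qed
  define S where "S i k s = (\<Sum>j<k. G j (r j) i s)" for i k s
  have A: "A k (r k) (G k (r k))" for k using G P by blast
  have tail: "\<bar>S i m s - S i k s\<bar> \<le> 2 * B * \<theta>^k" if "k \<le> m" for i k m s
  proof -
    have "\<bar>S i m s - S i k s\<bar> \<le> 2 * B * (\<theta>^k - \<theta>^m)" using that
    proof (induction m rule: dec_induct)
      case (step m)
      have "\<bar>G m (r m) i s\<bar> \<le> \<theta>^m * B / (real n + 1)" using A[of m] by (auto simp: A_def)
      also have "\<dots> = \<theta>^m * B * (2 * (1 - \<theta>))"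
      proof -
        have eq: "2 * (1 - \<theta>) = 1 / (real n + 1)" by (simp add: \<theta>_def field_simps)
        show ?thesis unfolding eq by simp
      qed
      also have "\<dots> = 2 * B * (\<theta>^m - \<theta>^Suc m)" by (simp add: algebra_simps)
      finally show ?case using step.IH by (simp add: S_def algebra_simps)
    qed simp
    also have "\<dots> \<le> 2 * B * \<theta>^k" using \<theta> B by (intro mult_left_mono) auto
    finally show ?thesis .
  qed
  have lim0: "(\<lambda>k. 2 * B * \<theta>^k) \<longlonglongrightarrow> 0"
    using \<theta> by (intro tendsto_mult_right_zero LIMSEQ_power_zero) auto
  have "\<exists>g. continuous_on UNIV g \<and> (\<forall>s. \<bar>g s\<bar> \<le> 2 * B) \<and> (\<forall>s. (\<lambda>k. S i k s) \<longlonglongrightarrow> g s)" for i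
  proof (rule continuous_limit_of_error_bounds[of UNIV "S i", OF _ tail lim0])
    show "continuous_on UNIV (S i k)" for k
      unfolding S_def using A by (intro continuous_intros) (auto simp: A_def)
    fix g assume "continuous_on UNIV g" and 1: "\<And>k s. s \<in> UNIV \<Longrightarrow> \<bar>g s - S i k s\<bar> \<le> 2 * B * \<theta>^k"
      and "\<And>s. s \<in> UNIV \<Longrightarrow> (\<lambda>k. S i k s) \<longlonglongrightarrow> g s"
    then show ?thesis using 1[of _ 0] by (auto simp: S_def)
  qed auto
  then obtain g where g: "\<And>i. continuous_on UNIV (g i)" "\<And>i s. \<bar>g i s\<bar> \<le> 2 * B" "\<And>i s. (\<lambda>k. S i k s) \<longlonglongrightarrow> g i s"
    by metis
  have "h x = (\<Sum>i<2*n+1. g i (\<psi> i x))" if x: "x \<in> F" for x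
  proof -
    have part: "(\<Sum>i<2*n+1. S i k (\<psi> i x)) = h x - r k x" for k
    proof (induction k)
      case 0 then show ?case by (simp add: S_def r)
    next
      case (Suc k)
      have "(\<Sum>i<2*n+1. S i (Suc k) (\<psi> i x)) = (\<Sum>i<2*n+1. S i k (\<psi> i x)) + (\<Sum>i<2*n+1. G k (r k) i (\<psi> i x))"
        unfolding sum.distrib[symmetric] by (simp add: S_def)
      then show ?case using Suc by (simp add: r)
    qed
    have "(\<lambda>k. r k x) \<longlonglongrightarrow> 0"
    proof (rule Lim_null_comparison)
      show "\<forall>\<^sub>F k in sequentially. norm (r k x) \<le> \<theta>^k * B"
        using P x by (intro always_eventually) (auto simp: P_def)
      show "(\<lambda>k. \<theta>^k * B) \<longlonglongrightarrow> 0"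
        using \<theta> by (intro tendsto_mult_left_zero LIMSEQ_power_zero) auto
    qed
    then have "(\<lambda>k. h x - r k x) \<longlonglongrightarrow> h x - 0" by (intro tendsto_intros)
    moreover have "(\<lambda>k. h x - r k x) \<longlonglongrightarrow> (\<Sum>i<2*n+1. g i (\<psi> i x))"
      unfolding part[symmetric] by (intro tendsto_intros g)
    ultimately show ?thesis using LIMSEQ_unique by fastforce
  qed
  with g show ?thesis by blast
qed

text \<open>The superposition theorem of Kolmogorov and Ostrand, with control of the norms: the inner
functions depend on \<open>F\<close> only, and the value of \<open>h\<close> at a point is given by the values of the \<open>N\<close> outer
functions at one real number each.\<close>

lemma kolmogorov_superposition:
  fixes F :: "'b::{metric_space,second_countable_topology} set"
  assumes F: "compact F" and dim: "finite_dimensional (top_of_set F)"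
  shows "\<exists>N \<psi>. (\<forall>i<N. continuous_on F (\<psi> i) \<and> \<psi> i ` F \<subseteq> {0..1::real}) \<and>
    (\<forall>(h::'b \<Rightarrow> real) B. continuous_on F h \<and> (\<forall>x\<in>F. \<bar>h x\<bar> \<le> B) \<and> B \<ge> 0 \<longrightarrow>
      (\<exists>g. (\<forall>i::nat. continuous_on UNIV (g i)) \<and> (\<forall>i s. \<bar>g i s\<bar> \<le> 2 * B) \<and>
        (\<forall>x\<in>F. h x = (\<Sum>i<N. g i (\<psi> i x)))))"
proof -
  obtain n where n: "covering_dim_le (top_of_set F) n" using dim by (auto simp: finite_dimensional_def)
  obtain \<psi> where \<psi>: "\<And>i. i < 2*n+1 \<Longrightarrow> continuous_on F (\<psi> i)"
    "\<And>i x. i < 2*n+1 \<Longrightarrow> x \<in> F \<Longrightarrow> \<psi> i x \<in> {0..1::real}"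
    "\<And>\<delta>. \<delta> > 0 \<Longrightarrow> \<exists>\<tau>>0. jointly_separates F n (2*n+1) \<delta> \<tau> \<psi>"
    by (rule jointly_separating_functions[OF F n, where N = "2*n+1"], (assumption | rule that)+)
  have main: "\<exists>g. (\<forall>i::nat. continuous_on UNIV (g i)) \<and> (\<forall>i s. \<bar>g i s\<bar> \<le> 2 * B) \<and>
      (\<forall>x\<in>F. h x = (\<Sum>i<2*n+1. g i (\<psi> i x)))"
    if h: "continuous_on F h" "\<forall>x\<in>F. \<bar>h x\<bar> \<le> B" "B \<ge> 0" for h and B :: real
  proof (cases "B = 0")
    case True
    then show ?thesis using h by (intro exI[of _ "\<lambda>_ _. 0"]) auto
  next
    case False
    with h have "\<And>x. x \<in> F \<Longrightarrow> \<bar>h x\<bar> \<le> B" "B > 0" by auto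
    from superposition_of_separating_functions[OF F \<psi>(1) \<psi>(3) h(1) this] show ?thesis by blast
  qed
  show ?thesis
  proof (intro exI conjI)
    show "\<forall>i<2*n+1. continuous_on F (\<psi> i) \<and> \<psi> i ` F \<subseteq> {0..1}" using \<psi>(1,2) by auto
  qed (intro allI impI, elim conjE, rule main)
qed

section \<open>Majorants, averages and functions with prescribed pieces\<close>

lemma abs_SUP_diff_le:
  fixes a b :: "'x \<Rightarrow> real"
  assumes "S \<noteq> {}" "bdd_above (a ` S)" "bdd_above (b ` S)" and le: "\<And>x. x \<in> S \<Longrightarrow> \<bar>a x - b x\<bar> \<le> e"
  shows "\<bar>(SUP x\<in>S. a x) - (SUP x\<in>S. b x)\<bar> \<le> e"
proof -
  have "(SUP x\<in>S. a x) \<le> (SUP x\<in>S. b x) + e"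
  proof (rule cSUP_least[OF assms(1)])
    fix x assume x: "x \<in> S"
    show "a x \<le> (SUP x\<in>S. b x) + e" using cSUP_upper[OF x assms(3)] le[OF x] by linarith
  qed
  moreover have "(SUP x\<in>S. b x) \<le> (SUP x\<in>S. a x) + e"
  proof (rule cSUP_least[OF assms(1)])
    fix x assume x: "x \<in> S"
    show "b x \<le> (SUP x\<in>S. a x) + e" using cSUP_upper[OF x assms(2)] le[OF x] by linarith
  qed
  ultimately show ?thesis by linarith
qed

text \<open>The function \<open>\<zeta> t\<close> is the supremum over \<open>x\<close> of \<open>\<bar>h x\<bar> * min 1 (t / u x)\<close>. As functions of \<open>t\<close> these
products are
equicontinuous: where \<open>u\<close> is bounded away from zero they are uniformly Lipschitz, and where \<open>u\<close> is
small so is \<open>h\<close>, by compactness.\<close>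

lemma continuous_majorant_along_function:
  fixes h u :: "'b::metric_space \<Rightarrow> real"
  assumes S: "compact S" and h: "continuous_on S h" and u: "continuous_on S u"
    and u01: "\<And>x. x \<in> S \<Longrightarrow> 0 \<le> u x \<and> u x \<le> 1"
    and zero: "\<And>x. x \<in> S \<Longrightarrow> u x = 0 \<Longrightarrow> h x = 0"
    and hB: "\<And>x. x \<in> S \<Longrightarrow> \<bar>h x\<bar> \<le> B" and B: "B \<ge> 0"
  shows "\<exists>\<zeta>. continuous_on {0..1::real} \<zeta> \<and> \<zeta> 0 = 0 \<and> (\<forall>t\<in>{0..1}. 0 \<le> \<zeta> t \<and> \<zeta> t \<le> B) \<and> (\<forall>x\<in>S. \<bar>h x\<bar> \<le> \<zeta> (u x))"
proof (cases "S = {}")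
  case True
  then show ?thesis using B by (intro exI[of _ "\<lambda>_. 0"]) auto
next
  case False
  define q where "q t x = \<bar>h x\<bar> * min 1 (t / u x)" for t x
  define \<zeta> where "\<zeta> t = (SUP x\<in>S. q t x)" for t
  have q: "0 \<le> q t x" "q t x \<le> \<bar>h x\<bar>" if "x \<in> S" "0 \<le> t" for t x
  proof -
    have "0 \<le> t / u x" using that u01 by simp
    then show "0 \<le> q t x" unfolding q_def by simp
    have "\<bar>h x\<bar> * min 1 (t / u x) \<le> \<bar>h x\<bar> * 1" by (intro mult_left_mono) auto
    then show "q t x \<le> \<bar>h x\<bar>" unfolding q_def by simp
  qed
  have bdd: "bdd_above (q t ` S)" if "0 \<le> t" for t
    using q(2)[OF _ that] hB by (intro bdd_aboveI2[of _ _ B]) (meson order_trans)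
  have le_\<zeta>: "q t x \<le> \<zeta> t" if "x \<in> S" "0 \<le> t" for t x
    unfolding \<zeta>_def by (rule cSUP_upper[OF that(1) bdd[OF that(2)]])
  have \<zeta>_le: "\<zeta> t \<le> B" if "0 \<le> t" for t
    unfolding \<zeta>_def using q(2)[OF _ that] hB by (intro cSUP_least[OF False]) (meson order_trans)
  obtain x0 where x0: "x0 \<in> S" using False by blast
  have "continuous_on {0..1} \<zeta>"
    unfolding continuous_on_iff
  proof (intro ballI allI impI)
    fix t e :: real assume t: "t \<in> {0..1}" and e: "e > 0"
    have "\<exists>d>0. \<forall>x\<in>S. u x < d \<longrightarrow> \<bar>h x\<bar> \<le> e/2"
    proof (cases "{x\<in>S. e/2 \<le> \<bar>h x\<bar>} = {}")
      case True
      then show ?thesis by (intro exI[of _ 1]) (auto simp: not_le less_imp_le)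
    next
      case ne: False
      let ?T = "{x\<in>S. e/2 \<le> \<bar>h x\<bar>}"
      have "closed ?T"
        by (intro continuous_on_closed_Collect_le continuous_intros h compact_imp_closed S)
      then have "compact (S \<inter> ?T)" using S by (rule compact_Int_closed[rotated])
      then have "compact ?T" by (metis (no_types, lifting) Int_absorb1 mem_Collect_eq subsetI)
      then obtain z where z: "z \<in> ?T" "\<And>x. x \<in> ?T \<Longrightarrow> u z \<le> u x"
        using continuous_attains_inf[OF _ ne continuous_on_subset[OF u]] by blast
      have "u z \<noteq> 0" using z(1) zero[of z] e by auto
      then have "u z > 0" using u01[of z] z(1) by auto
      moreover have "\<bar>h x\<bar> \<le> e/2" if "x \<in> S" "u x < u z" for x
        using z(2)[of x] that by force
      ultimately show ?thesis by blast
    qed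
    then obtain d where d: "d > 0" "\<And>x. x \<in> S \<Longrightarrow> u x < d \<Longrightarrow> \<bar>h x\<bar> \<le> e/2" by blast
    define \<delta> where "\<delta> = e/2 * d / (B + 1)"
    have \<delta>: "\<delta> > 0" using e d B by (simp add: \<delta>_def)
    have "dist (\<zeta> s) (\<zeta> t) < e" if s: "s \<in> {0..1}" "dist s t < \<delta>" for s
    proof -
      have "\<bar>q s x - q t x\<bar> \<le> e/2" if x: "x \<in> S" for x
      proof (cases "u x < d")
        case True
        have "0 \<le> s" "0 \<le> t" using s t by auto
        then show ?thesis using q[OF x, of s] q[OF x, of t] d(2)[OF x True] by linarith
      next
        case False
        have "\<bar>min 1 (s / u x) - min 1 (t / u x)\<bar> \<le> \<bar>s / u x - t / u x\<bar>" by linarith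
        also have "\<dots> = \<bar>s - t\<bar> / u x" using False d(1) by (simp add: abs_divide flip: diff_divide_distrib)
        also have "\<dots> \<le> \<delta> / d" using False d(1) s(2) by (intro frac_le) (auto simp: dist_real_def)
        finally have "\<bar>h x\<bar> * \<bar>min 1 (s / u x) - min 1 (t / u x)\<bar> \<le> (B + 1) * (\<delta> / d)"
          using hB[OF x] B by (intro mult_mono) auto
        also have "\<dots> = e/2"
        proof -
          have cancel: "C * (e/2 * d / C / d) = e/2" if "C \<noteq> 0" for C using that d(1) by simp
          show ?thesis unfolding \<delta>_def by (rule cancel) (use B in simp)
        qed
        finally show ?thesis unfolding q_def by (simp add: abs_mult flip: right_diff_distrib)
      qed
      then have "\<bar>\<zeta> s - \<zeta> t\<bar> \<le> e/2"
        unfolding \<zeta>_def using s t by (intro abs_SUP_diff_le False bdd) auto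
      then show ?thesis using e by (simp add: dist_real_def)
    qed
    then show "\<exists>d>0. \<forall>x'\<in>{0..1}. dist x' t < d \<longrightarrow> dist (\<zeta> x') (\<zeta> t) < e" using \<delta> by blast
  qed
  moreover have "\<zeta> 0 = 0" using False by (simp add: \<zeta>_def q_def)
  moreover have "0 \<le> \<zeta> t" if "t \<in> {0..1}" for t
    using le_\<zeta>[OF x0, of t] q(1)[OF x0, of t] that by auto
  moreover have "\<bar>h x\<bar> \<le> \<zeta> (u x)" if x: "x \<in> S" for x
  proof (cases "u x = 0")
    case True
    then show ?thesis using zero[OF x] \<open>\<zeta> 0 = 0\<close> by simp
  next
    case False
    then have "q (u x) x = \<bar>h x\<bar>" by (simp add: q_def)
    then show ?thesis using le_\<zeta>[OF x] u01[OF x] by metis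
  qed
  ultimately show ?thesis using \<zeta>_le by (intro exI[of _ \<zeta>]) auto
qed

lemma partition_of_unity_at_scale:
  fixes S :: "'b::metric_space set"
  assumes S: "compact S" and \<delta>: "\<delta> > 0"
  shows "\<exists>(m::nat) a \<mu>. (\<forall>j<m. a j \<in> S) \<and> (\<forall>j<m. continuous_on S (\<mu> j)) \<and>
    (\<forall>j<m. \<forall>x\<in>S. 0 \<le> \<mu> j x \<and> (dist x (a j) \<ge> \<delta> \<longrightarrow> \<mu> j x = 0)) \<and>
    (\<forall>x\<in>S. (\<Sum>j<m. \<mu> j x) = (1::real))"
proof -
  obtain C where C: "C \<subseteq> S" "finite C" "S \<subseteq> (\<Union>c\<in>C. ball c \<delta>)"
    using compactE_image[OF S, of S "\<lambda>c. ball c \<delta>"] \<delta>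
    by (metis (no_types, lifting) UN_iff centre_in_ball open_ball subsetI)
  obtain a where a: "bij_betw a {0..<card C} C" using ex_bij_betw_nat_finite[OF C(2)] by blast
  define m where "m = card C"
  have aS: "a j \<in> S" if "j < m" for j using bij_betwE[OF a] that C(1) by (auto simp: m_def)
  define b where "b j x = max 0 (\<delta> - dist x (a j))" for j x
  define T where "T x = (\<Sum>j<m. b j x)" for x
  have T: "T x > 0" if "x \<in> S" for x
  proof -
    obtain c where "c \<in> C" "dist c x < \<delta>" using C(3) \<open>x \<in> S\<close> by auto
    moreover obtain j where "j < m" "a j = c"
      using \<open>c \<in> C\<close> a unfolding bij_betw_def m_def by (metis atLeastLessThan_iff imageE)
    ultimately have "b j x > 0" "j \<in> {..<m}" by (auto simp: b_def dist_commute)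
    then show ?thesis unfolding T_def by (intro sum_pos2[of _ j]) (auto simp: b_def)
  qed
  show ?thesis
  proof (intro exI[of _ m] exI[of _ a] exI[of _ "\<lambda>j x. b j x / T x"] conjI allI impI ballI)
    show "continuous_on S (\<lambda>x. b j x / T x)" if "j < m" for j
    proof -
      have "continuous_on S (b j)" for j unfolding b_def by (intro continuous_intros)
      moreover from this have "continuous_on S T" unfolding T_def by (intro continuous_intros)
      moreover have "\<forall>x\<in>S. T x \<noteq> 0" using T by (metis less_irrefl)
      ultimately show ?thesis by (intro continuous_on_divide)
    qed
    show "0 \<le> b j x / T x" if "x \<in> S" for j x using T[OF that] by (simp add: b_def)
    show "(\<Sum>j<m. b j x / T x) = 1" if "x \<in> S" for x
      using T[OF that] by (simp add: T_def flip: sum_divide_distrib)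
  qed (use aS in \<open>auto simp: b_def\<close>)
qed

text \<open>Averaging a function over partitions of unity of mesh tending to zero: a uniform approximation of
\<open>f\<close> that only looks at finitely many values of \<open>f\<close>.\<close>

lemma finite_averaging_operators:
  fixes S :: "'b::metric_space set"
  assumes S: "compact S"
  shows "\<exists>(m::nat \<Rightarrow> nat) a \<mu>. (\<forall>n. \<forall>j<m n. a n j \<in> S \<and> continuous_on S (\<mu> n j)) \<and>
    (\<forall>f::'b \<Rightarrow> real. continuous_on S f \<longrightarrow>
      (\<exists>\<alpha>. \<alpha> \<longlonglongrightarrow> 0 \<and> (\<forall>n. \<forall>x\<in>S. \<bar>f x - (\<Sum>j<m n. \<mu> n j x * f (a n j))\<bar> \<le> \<alpha> n)))"
proof -
  have "\<exists>(m::nat) a \<mu>. (\<forall>j<m. a j \<in> S) \<and> (\<forall>j<m. continuous_on S (\<mu> j)) \<and>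
    (\<forall>j<m. \<forall>x\<in>S. 0 \<le> \<mu> j x \<and> (dist x (a j) \<ge> 1 / real (Suc n) \<longrightarrow> \<mu> j x = 0)) \<and>
    (\<forall>x\<in>S. (\<Sum>j<m. \<mu> j x) = (1::real))" for n
    by (rule partition_of_unity_at_scale[OF S]) simp
  then obtain m :: "nat \<Rightarrow> nat" and a \<mu> where aS: "\<And>n. \<forall>j<m n. a n j \<in> S" and cont: "\<And>n. \<forall>j<m n. continuous_on S (\<mu> n j)"
    and \<mu>: "\<And>n. \<forall>j<m n. \<forall>x\<in>S. 0 \<le> \<mu> n j x \<and> (dist x (a n j) \<ge> 1 / real (Suc n) \<longrightarrow> \<mu> n j x = (0::real))"
    and one: "\<And>n. \<forall>x\<in>S. (\<Sum>j<m n. \<mu> n j x) = 1" by metis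
  have main: "\<exists>\<alpha>. \<alpha> \<longlonglongrightarrow> 0 \<and> (\<forall>n. \<forall>x\<in>S. \<bar>f x - (\<Sum>j<m n. \<mu> n j x * f (a n j))\<bar> \<le> \<alpha> n)"
    if f: "continuous_on S f" for f :: "'b \<Rightarrow> real"
  proof (cases "S = {}")
    case True then show ?thesis by auto
  next
    case False
    define err where "err n x = \<bar>f x - (\<Sum>j<m n. \<mu> n j x * f (a n j))\<bar>" for n x
    have "continuous_on S (err n)" for n
      unfolding err_def using cont by (intro continuous_intros f) auto
    then have "compact (err n ` S)" for n using S compact_continuous_image by blast
    then have bdd: "bdd_above (err n ` S)" for n by (intro bounded_imp_bdd_above compact_imp_bounded)
    define \<alpha> where "\<alpha> n = (SUP x\<in>S. err n x)" for n
    have le: "err n x \<le> \<alpha> n" if "x \<in> S" for n x unfolding \<alpha>_def by (rule cSUP_upper[OF that bdd])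
    obtain x0 where x0: "x0 \<in> S" using False by blast
    have "\<alpha> \<longlonglongrightarrow> 0"
    proof (rule LIMSEQ_I)
      fix e :: real assume e: "e > 0"
      have "uniformly_continuous_on S f" by (rule compact_uniformly_continuous[OF f S])
      then obtain d where d: "d > 0" "\<And>x y. x \<in> S \<Longrightarrow> y \<in> S \<Longrightarrow> dist x y < d \<Longrightarrow> \<bar>f x - f y\<bar> < e/2"
        unfolding uniformly_continuous_on_def dist_real_def using e by (meson half_gt_zero)
      obtain N where N: "1 / real (Suc N) < d" using nat_approx_posE[OF d(1)] by metis
      show "\<exists>no. \<forall>n\<ge>no. norm (\<alpha> n - 0) < e"
      proof (intro exI[of _ N] allI impI)
        fix n assume "N \<le> n"
        then have "1 / real (Suc n) \<le> 1 / real (Suc N)" by (simp add: field_simps)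
        with N have n: "1 / real (Suc n) < d" by linarith
        have "err n x \<le> e/2" if x: "x \<in> S" for x
        proof -
          have "f x - (\<Sum>j<m n. \<mu> n j x * f (a n j)) = (\<Sum>j<m n. \<mu> n j x) * f x - (\<Sum>j<m n. \<mu> n j x * f (a n j))"
            using one x by simp
          also have "\<dots> = (\<Sum>j<m n. \<mu> n j x * (f x - f (a n j)))"
            by (simp add: sum_distrib_right sum_subtractf right_diff_distrib)
          also have "\<bar>\<dots>\<bar> \<le> (\<Sum>j<m n. \<mu> n j x * (e/2))"
          proof (intro order_trans[OF sum_abs sum_mono])
            fix j assume "j \<in> {..<m n}"
            then have j: "j < m n" by simp
            show "\<bar>\<mu> n j x * (f x - f (a n j))\<bar> \<le> \<mu> n j x * (e/2)"
            proof (cases "dist x (a n j) \<ge> 1 / real (Suc n)")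
              case True
              then have "\<mu> n j x = 0" using \<mu>[of n] j x by blast
              then show ?thesis by simp
            next
              case False
              then have "\<bar>f x - f (a n j)\<bar> < e/2" using n aS j x by (intro d(2)) auto
              moreover have "0 \<le> \<mu> n j x" using \<mu>[of n] j x by blast
              ultimately have "\<mu> n j x * \<bar>f x - f (a n j)\<bar> \<le> \<mu> n j x * (e/2)" by (intro mult_left_mono) auto
              then show ?thesis using \<open>0 \<le> \<mu> n j x\<close> by (simp only: abs_mult abs_of_nonneg)
            qed
          qed
          also have "\<dots> = e/2" unfolding sum_distrib_right[symmetric] using one x by simp
          finally show ?thesis by (simp add: err_def)
        qed
        then have "\<alpha> n \<le> e/2" unfolding \<alpha>_def by (intro cSUP_least[OF False])
        moreover have "0 \<le> \<alpha> n" using le[OF x0, of n] by (simp add: err_def)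
        ultimately show "norm (\<alpha> n - 0) < e" using e by simp
      qed
    qed
    then show ?thesis using le unfolding err_def by blast
  qed
  show ?thesis
  proof (rule exI[of _ m], rule exI[of _ a], rule exI[of _ \<mu>], rule conjI)
    show "\<forall>n. \<forall>j<m n. a n j \<in> S \<and> continuous_on S (\<mu> n j)" using aS cont by auto
  qed (intro allI impI, rule main)
qed

text \<open>The middle third of the interval from \<open>1 / (k + 2)\<close> to \<open>1 / (k + 1)\<close>, parametrised by the unit
interval. A continuous function \<open>G\<close> on the unit interval thus carries a sequence of functions
\<open>G \<circ> piece_point k\<close>.\<close>

definition piece_point :: "nat \<Rightarrow> real \<Rightarrow> real" where
  "piece_point k t = 1 / real (k + 2) + (1 / real (k + 1) - 1 / real (k + 2)) * ((1 + t) / 3)"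

lemma piece_point_bounds:
  assumes "t \<in> {0..1}"
  shows "0 \<le> piece_point k t" "piece_point k t \<le> 1 / real (k + 1)" "piece_point k t \<in> {0..1}"
proof -
  have d: "1 / real (k + 2) \<le> 1 / real (k + 1)" by (simp add: field_simps)
  define D where "D = 1 / real (k + 1) - 1 / real (k + 2)"
  define y where "y = D * ((1 + t) / 3)"
  have D: "D \<ge> 0" "piece_point k t = 1 / real (k + 2) + y"
    using d by (auto simp: D_def y_def piece_point_def)
  have "0 \<le> y" using D(1) assms by (simp add: y_def)
  then show 0: "0 \<le> piece_point k t" unfolding D(2) by (intro add_nonneg_nonneg) simp
  have "y \<le> D * 1" unfolding y_def using D(1) assms by (intro mult_left_mono) auto
  then show 1: "piece_point k t \<le> 1 / real (k + 1)" unfolding D(2) by (simp add: D_def)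
  have "1 / real (k + 1) \<le> 1" by simp
  with 1 have "piece_point k t \<le> 1" by (rule order_trans)
  with 0 show "piece_point k t \<in> {0..1}" by simp
qed

lemma continuous_piece_point: "continuous_on A (piece_point k)"
  unfolding piece_point_def by (intro continuous_intros) auto

text \<open>The only restriction on the functions carried by \<open>G\<close> is that they converge uniformly to \<open>G 0\<close>. Each
\<open>\<gamma> k\<close>, extended to be constant outside its interval, is multiplied by a tent function that is 1 on the
middle third and vanishes outside the interval; the sum converges uniformly because at every point at
most one summand is not zero.\<close>

lemma continuous_function_with_prescribed_pieces:
  fixes \<gamma> :: "nat \<Rightarrow> real \<Rightarrow> real"
  assumes cont: "\<And>k. continuous_on {0..1} (\<gamma> k)"
    and small: "\<And>e. e > 0 \<Longrightarrow> finite {k. \<exists>t\<in>{0..1}. \<bar>\<gamma> k t\<bar> \<ge> e}"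
  obtains G where "continuous_on {0..1} G" "G 0 = 0" "\<And>k t. t \<in> {0..1} \<Longrightarrow> G (piece_point k t) = \<gamma> k t"
proof -
  define r where "r k = 1 / real (k + 1)" for k
  have r_less: "r (Suc k) < r k" for k by (simp add: r_def field_simps)
  have r_mono: "r l \<le> r k" if "k \<le> l" for k l using that by (simp add: r_def field_simps)
  define c where "c k x = (x - r (Suc k)) / (r k - r (Suc k))" for k x
  define I where "I k x \<longleftrightarrow> r (Suc k) < x \<and> x < r k" for k x
  have I_unique: "k = l" if "I k x" "I l x" for k l x
  proof (rule ccontr)
    assume "k \<noteq> l"
    then consider "Suc k \<le> l" | "Suc l \<le> k" by linarith
    then show False using r_mono that unfolding I_def by cases (meson not_less order_trans less_imp_le less_le_trans)+
  qed
  define w where "w k x = \<gamma> k (max 0 (min 1 (3 * c k x - 1))) * max 0 (min 1 (3 * min (c k x) (1 - c k x)))" for k x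
  have w_cont: "continuous_on A (w k)" for k A
  proof -
    have 1: "continuous_on A (c k)" unfolding c_def using r_less[of k] by (intro continuous_intros) auto
    have "continuous_on A (\<lambda>x. \<gamma> k (max 0 (min 1 (3 * c k x - 1))))"
      by (rule continuous_on_compose2[OF cont]) (intro continuous_intros 1, auto)
    then show ?thesis unfolding w_def by (intro continuous_intros 1)
  qed
  have w_zero: "w k x = 0" if "\<not> I k x" for k x
  proof -
    have "c k x \<le> 0 \<or> 1 \<le> c k x" using that r_less[of k] by (auto simp: I_def c_def field_simps)
    then have "min (c k x) (1 - c k x) \<le> 0" by linarith
    then show ?thesis by (simp add: w_def)
  qed
  have w_le: "\<exists>t\<in>{0..1}. \<bar>w k x\<bar> \<le> \<bar>\<gamma> k t\<bar>" for k x
  proof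
    show "max 0 (min 1 (3 * c k x - 1)) \<in> {0..1}" by auto
    have "\<bar>w k x\<bar> \<le> \<bar>\<gamma> k (max 0 (min 1 (3 * c k x - 1)))\<bar> * 1"
      unfolding w_def abs_mult by (intro mult_left_mono) auto
    then show "\<bar>w k x\<bar> \<le> \<bar>\<gamma> k (max 0 (min 1 (3 * c k x - 1)))\<bar>" by simp
  qed
  define G where "G x = (if \<exists>k. I k x then w (THE k. I k x) x else 0)" for x
  have G: "G x = w k x" if "I k x" for k x
    using that I_unique by (auto simp: G_def intro!: arg_cong2[where f = w] the_equality)
  have "uniform_limit UNIV (\<lambda>K x. \<Sum>k<K. w k x) G sequentially"
    unfolding uniform_limit_iff eventually_sequentially
  proof (intro allI impI)
    fix e :: real assume e: "e > 0"
    obtain K where K: "\<And>k t. k \<ge> K \<Longrightarrow> t \<in> {0..1} \<Longrightarrow> \<bar>\<gamma> k t\<bar> < e"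
      using small[OF e] unfolding finite_nat_set_iff_bounded
      by (metis (mono_tags, lifting) mem_Collect_eq not_less)
    have "dist (\<Sum>k<n. w k x) (G x) < e" if n: "n \<ge> K" for n x
    proof (cases "\<exists>k. I k x")
      case True
      then obtain k where k: "I k x" by blast
      have "w j x = 0" if "j \<noteq> k" for j using that w_zero I_unique[OF k] by blast
      then have "(\<Sum>j<n. w j x) = (\<Sum>j<n. if j = k then w k x else 0)"
        by (intro sum.cong) auto
      also have "\<dots> = (if k < n then w k x else 0)" by simp
      finally have "dist (\<Sum>j<n. w j x) (G x) = (if k < n then 0 else \<bar>w k x\<bar>)"
        using G[OF k] by (simp add: dist_real_def)
      then show ?thesis using e K[of k] w_le[of k x] n by fastforce
    next
      case False
      then have "w j x = 0" for j using w_zero by blast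
      then show ?thesis using False e by (simp add: G_def)
    qed
    then show "\<exists>N. \<forall>n\<ge>N. \<forall>x\<in>UNIV. dist (\<Sum>k<n. w k x) (G x) < e" by blast
  qed
  then have "continuous_on UNIV G"
    by (rule uniform_limit_theorem[rotated]) (auto intro!: always_eventually continuous_intros w_cont)
  then have "continuous_on {0..1} G" by (rule continuous_on_subset) simp
  moreover have "G 0 = 0"
  proof -
    have "\<not> I k 0" for k by (simp add: I_def r_def)
    then show ?thesis by (simp add: G_def)
  qed
  moreover have "G (piece_point k t) = \<gamma> k t" if t: "t \<in> {0..1}" for k t
  proof -
    have x: "piece_point k t = r (Suc k) + (r k - r (Suc k)) * ((1 + t) / 3)"
      by (simp add: piece_point_def r_def add.commute)
    have c: "c k (piece_point k t) = (1 + t) / 3"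
    proof -
      have cancel: "(z + d * y - z) / d = y" if "d \<noteq> 0" for z d y :: real using that by simp
      show ?thesis unfolding x c_def by (rule cancel) (use r_less[of k] in simp)
    qed
    have "I k (piece_point k t)"
    proof -
      define d where "d = r k - r (Suc k)"
      have d: "d > 0" "r k = r (Suc k) + d" using r_less[of k] by (auto simp: d_def)
      have "0 < d * ((1 + t) / 3)" using d(1) t by simp
      moreover have "d * ((1 + t) / 3) < d * 1"
        using d(1) t by (intro mult_strict_left_mono) auto
      ultimately show ?thesis unfolding I_def x d_def[symmetric] d(2) by simp
    qed
    moreover have "w k (piece_point k t) = \<gamma> k t"
    proof -
      have "3 * ((1 + t) / 3) - 1 = t" by (simp add: field_simps)
      then have 1: "max 0 (min 1 (3 * ((1 + t) / 3) - 1)) = t" using t by auto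
      have "1 / 3 \<le> min ((1 + t) / 3) (1 - (1 + t) / 3)" using t by (auto simp: field_simps)
      moreover have "max 0 (min 1 (3 * y)) = 1" if "1 / 3 \<le> y" for y :: real using that by linarith
      ultimately have 2: "max 0 (min 1 (3 * min ((1 + t) / 3) (1 - (1 + t) / 3))) = 1" by blast
      show ?thesis unfolding w_def c 1 2 by simp
    qed
    ultimately show ?thesis using G by simp
  qed
  ultimately show ?thesis by (rule that)
qed

section \<open>Functionals controlled by finitely many values\<close>

text \<open>This is the pointwise form of uniform continuity between function spaces with the topology of
pointwise convergence, with a linear bound because such bounds add up under the vector space and lattice
operations.\<close>

definition finitely_lipschitz :: "(('x \<Rightarrow> real) \<Rightarrow> real) \<Rightarrow> 'x set \<Rightarrow> bool" where
  "finitely_lipschitz \<Phi> X \<longleftrightarrow>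
     (\<exists>A C. finite A \<and> A \<subseteq> X \<and> (\<forall>f g. \<bar>\<Phi> f - \<Phi> g\<bar> \<le> C * (\<Sum>a\<in>A. \<bar>f a - g a\<bar>)))"

lemma finitely_lipschitz_const: "finitely_lipschitz (\<lambda>f. c) X"
  unfolding finitely_lipschitz_def by (intro exI[of _ "{}"]) auto

lemma finitely_lipschitz_eval: "x \<in> X \<Longrightarrow> finitely_lipschitz (\<lambda>f. f x) X"
  unfolding finitely_lipschitz_def by (intro exI[of _ "{x}"] exI[of _ 1]) auto

lemma finitely_lipschitz_dominated:
  assumes "finitely_lipschitz \<Phi> X" "finitely_lipschitz \<Psi> X" and c: "0 \<le> c"
    and le: "\<And>f g. \<bar>\<Theta> f - \<Theta> g\<bar> \<le> c * (\<bar>\<Phi> f - \<Phi> g\<bar> + \<bar>\<Psi> f - \<Psi> g\<bar>)"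
  shows "finitely_lipschitz \<Theta> X"
proof -
  obtain A C where A: "finite A" "A \<subseteq> X" and AC: "\<And>f g. \<bar>\<Phi> f - \<Phi> g\<bar> \<le> C * (\<Sum>a\<in>A. \<bar>f a - g a\<bar>)"
    using assms(1) unfolding finitely_lipschitz_def by auto
  obtain B D where B: "finite B" "B \<subseteq> X" and BD: "\<And>f g. \<bar>\<Psi> f - \<Psi> g\<bar> \<le> D * (\<Sum>a\<in>B. \<bar>f a - g a\<bar>)"
    using assms(2) unfolding finitely_lipschitz_def by auto
  have "\<bar>\<Theta> f - \<Theta> g\<bar> \<le> (c * (\<bar>C\<bar> + \<bar>D\<bar>)) * (\<Sum>a\<in>A \<union> B. \<bar>f a - g a\<bar>)" for f g
  proof -
    let ?s = "\<lambda>A. \<Sum>a\<in>A. \<bar>f a - g a\<bar>"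
    have "C * ?s A \<le> \<bar>C\<bar> * ?s (A \<union> B)"
      by (intro mult_mono sum_mono2) (use A B in \<open>auto intro: sum_nonneg\<close>)
    moreover have "D * ?s B \<le> \<bar>D\<bar> * ?s (A \<union> B)"
      by (intro mult_mono sum_mono2) (use A B in \<open>auto intro: sum_nonneg\<close>)
    ultimately have "\<bar>\<Phi> f - \<Phi> g\<bar> + \<bar>\<Psi> f - \<Psi> g\<bar> \<le> (\<bar>C\<bar> + \<bar>D\<bar>) * ?s (A \<union> B)"
      using AC[of f g] BD[of f g] by (simp add: distrib_right)
    then show ?thesis using le[of f g] mult_left_mono[OF _ c] by (fastforce simp: mult.assoc)
  qed
  then show ?thesis unfolding finitely_lipschitz_def using A B by (intro exI[of _ "A \<union> B"]) auto
qed

lemma finitely_lipschitz_add: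
  assumes "finitely_lipschitz \<Phi> X" "finitely_lipschitz \<Psi> X"
  shows "finitely_lipschitz (\<lambda>f. \<Phi> f + \<Psi> f) X"
proof (rule finitely_lipschitz_dominated[OF assms zero_le_one])
  show "\<bar>\<Phi> f + \<Psi> f - (\<Phi> g + \<Psi> g)\<bar> \<le> 1 * (\<bar>\<Phi> f - \<Phi> g\<bar> + \<bar>\<Psi> f - \<Psi> g\<bar>)" for f g
    unfolding mult_1 by linarith
qed

lemma finitely_lipschitz_diff:
  assumes "finitely_lipschitz \<Phi> X" "finitely_lipschitz \<Psi> X"
  shows "finitely_lipschitz (\<lambda>f. \<Phi> f - \<Psi> f) X"
proof (rule finitely_lipschitz_dominated[OF assms zero_le_one])
  show "\<bar>\<Phi> f - \<Psi> f - (\<Phi> g - \<Psi> g)\<bar> \<le> 1 * (\<bar>\<Phi> f - \<Phi> g\<bar> + \<bar>\<Psi> f - \<Psi> g\<bar>)" for f g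
    unfolding mult_1 by linarith
qed

lemma finitely_lipschitz_max:
  assumes "finitely_lipschitz \<Phi> X" "finitely_lipschitz \<Psi> X"
  shows "finitely_lipschitz (\<lambda>f. max (\<Phi> f) (\<Psi> f)) X"
proof (rule finitely_lipschitz_dominated[OF assms zero_le_one])
  show "\<bar>max (\<Phi> f) (\<Psi> f) - (max (\<Phi> g) (\<Psi> g))\<bar> \<le> 1 * (\<bar>\<Phi> f - \<Phi> g\<bar> + \<bar>\<Psi> f - \<Psi> g\<bar>)" for f g
    unfolding mult_1 by linarith
qed

lemma finitely_lipschitz_min:
  assumes "finitely_lipschitz \<Phi> X" "finitely_lipschitz \<Psi> X"
  shows "finitely_lipschitz (\<lambda>f. min (\<Phi> f) (\<Psi> f)) X"
proof (rule finitely_lipschitz_dominated[OF assms zero_le_one])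
  show "\<bar>min (\<Phi> f) (\<Psi> f) - (min (\<Phi> g) (\<Psi> g))\<bar> \<le> 1 * (\<bar>\<Phi> f - \<Phi> g\<bar> + \<bar>\<Psi> f - \<Psi> g\<bar>)" for f g
    unfolding mult_1 by linarith
qed

lemma finitely_lipschitz_abs:
  assumes "finitely_lipschitz \<Phi> X"
  shows "finitely_lipschitz (\<lambda>f. \<bar>\<Phi> f\<bar>) X"
proof (rule finitely_lipschitz_dominated[OF assms assms zero_le_one])
  show "\<bar>\<bar>\<Phi> f\<bar> - (\<bar>\<Phi> g\<bar>)\<bar> \<le> 1 * (\<bar>\<Phi> f - \<Phi> g\<bar> + \<bar>\<Phi> f - \<Phi> g\<bar>)" for f g
    unfolding mult_1 by linarith
qed

lemma finitely_lipschitz_minus: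
  assumes "finitely_lipschitz \<Phi> X"
  shows "finitely_lipschitz (\<lambda>f. - \<Phi> f) X"
proof (rule finitely_lipschitz_dominated[OF assms assms zero_le_one])
  show "\<bar>- \<Phi> f - (- \<Phi> g)\<bar> \<le> 1 * (\<bar>\<Phi> f - \<Phi> g\<bar> + \<bar>\<Phi> f - \<Phi> g\<bar>)" for f g
    unfolding mult_1 by linarith
qed

lemma finitely_lipschitz_cmult:
  assumes "finitely_lipschitz \<Phi> X"
  shows "finitely_lipschitz (\<lambda>f. c * \<Phi> f) X"
proof (rule finitely_lipschitz_dominated[OF assms assms abs_ge_zero])
  show "\<bar>c * \<Phi> f - c * \<Phi> g\<bar> \<le> \<bar>c\<bar> * (\<bar>\<Phi> f - \<Phi> g\<bar> + \<bar>\<Phi> f - \<Phi> g\<bar>)" for f g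
    unfolding right_diff_distrib[symmetric] abs_mult by (intro mult_left_mono) auto
qed

lemma finitely_lipschitz_sum:
  "finite I \<Longrightarrow> (\<And>i. i \<in> I \<Longrightarrow> finitely_lipschitz (\<Phi> i) X) \<Longrightarrow> finitely_lipschitz (\<lambda>f. \<Sum>i\<in>I. \<Phi> i f) X"
  by (induction I rule: finite_induct) (auto intro: finitely_lipschitz_const finitely_lipschitz_add)

lemmas finitely_lipschitz_intros =
  finitely_lipschitz_const finitely_lipschitz_eval finitely_lipschitz_add finitely_lipschitz_diff
  finitely_lipschitz_max finitely_lipschitz_min finitely_lipschitz_abs finitely_lipschitz_minus
  finitely_lipschitz_cmult finitely_lipschitz_sum

text \<open>A basic neighbourhood of zero restricts finitely many values only, and each of them is controlled by
finitely many values of the argument.\<close>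

lemma finitely_lipschitz_imp_Cp_uniformly_continuous:
  assumes maps: "\<phi> \<in> topspace (Cp X) \<rightarrow> topspace (Cp Y)"
    and lip: "\<And>y. y \<in> topspace Y \<Longrightarrow> finitely_lipschitz (\<lambda>f. \<phi> f y) (topspace X)"
  shows "Cp_uniformly_continuous X Y \<phi>"
  unfolding Cp_uniformly_continuous_def
proof (intro conjI maps allI impI, elim conjE)
  fix U assume U: "openin (Cp Y) U" "Cp_zero Y \<in> U"
  let ?PY = "product_topology (\<lambda>_. euclideanreal) (topspace Y)"
  obtain T where T: "openin ?PY T" "U = T \<inter> {f. continuous_map Y euclideanreal f}"
    using U(1) unfolding Cp_def openin_subtopology by blast
  obtain W where W: "Cp_zero Y \<in> (\<Pi>\<^sub>E y\<in>topspace Y. W y)" "\<And>y. open (W y)"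
      "finite {y. W y \<noteq> UNIV}" "(\<Pi>\<^sub>E y\<in>topspace Y. W y) \<subseteq> T"
    using product_topology_open_contains_basis[OF T(1), of "Cp_zero Y"] U(2) T(2) by auto
  define J where "J = {y\<in>topspace Y. W y \<noteq> UNIV}"
  have J: "finite J" using W(3) by (rule finite_subset[rotated]) (auto simp: J_def)
  have "\<exists>e>0. \<forall>r. \<bar>r\<bar> < e \<longrightarrow> r \<in> W y" if "y \<in> J" for y
  proof -
    have "0 \<in> W y" using W(1) that by (auto simp: Cp_zero_def J_def PiE_iff)
    then show ?thesis using W(2)[of y] by (force simp: open_dist dist_real_def)
  qed
  then obtain e where e: "\<And>y. y \<in> J \<Longrightarrow> e y > 0" "\<And>y r. y \<in> J \<Longrightarrow> \<bar>r\<bar> < e y \<Longrightarrow> r \<in> W y"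
    by metis
  have "\<exists>A \<delta>. finite A \<and> A \<subseteq> topspace X \<and> \<delta> > 0 \<and>
      (\<forall>f g. (\<forall>a\<in>A. \<bar>f a - g a\<bar> < \<delta>) \<longrightarrow> \<bar>\<phi> f y - \<phi> g y\<bar> < e y)" if y: "y \<in> J" for y
  proof -
    have "y \<in> topspace Y" using y by (simp add: J_def)
    from lip[OF this] obtain A c where A: "finite A" "A \<subseteq> topspace X"
      and c: "\<And>f g. \<bar>\<phi> f y - \<phi> g y\<bar> \<le> c * (\<Sum>a\<in>A. \<bar>f a - g a\<bar>)"
      unfolding finitely_lipschitz_def by auto
    define \<delta> where "\<delta> = e y / ((\<bar>c\<bar> + 1) * (real (card A) + 1))"
    have \<delta>: "\<delta> > 0" using e(1)[OF y] by (simp add: \<delta>_def)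
    have "\<bar>\<phi> f y - \<phi> g y\<bar> < e y" if "\<forall>a\<in>A. \<bar>f a - g a\<bar> < \<delta>" for f g
    proof -
      have "(\<Sum>a\<in>A. \<bar>f a - g a\<bar>) \<le> (\<Sum>a\<in>A. \<delta>)" using that by (intro sum_mono) auto
      then have "c * (\<Sum>a\<in>A. \<bar>f a - g a\<bar>) \<le> \<bar>c\<bar> * (card A * \<delta>)"
        by (intro mult_mono) (auto intro: sum_nonneg)
      also have "\<dots> \<le> (\<bar>c\<bar> + 1) * (card A * \<delta>)" using \<delta> by (intro mult_right_mono) auto
      also have "\<dots> < (\<bar>c\<bar> + 1) * ((real (card A) + 1) * \<delta>)"
        using \<delta> by (intro mult_strict_left_mono mult_strict_right_mono) auto
      also have "\<dots> = e y"
      proof -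
        have cancel: "p * (q * (r / (p * q))) = r" if "p > 0" "q > 0" for p q r :: real using that by simp
        show ?thesis unfolding \<delta>_def by (rule cancel) auto
      qed
      finally show ?thesis using c[of f g] by linarith
    qed
    then show ?thesis using A \<delta> by blast
  qed
  then obtain A \<delta> where A: "\<And>y. y \<in> J \<Longrightarrow> finite (A y) \<and> A y \<subseteq> topspace X \<and> \<delta> y > 0 \<and>
      (\<forall>f g. (\<forall>a\<in>A y. \<bar>f a - g a\<bar> < \<delta> y) \<longrightarrow> \<bar>\<phi> f y - \<phi> g y\<bar> < e y)" by metis
  define A' where "A' = (\<Union>y\<in>J. A y)"
  define \<epsilon> where "\<epsilon> = Min (insert 1 (\<delta> ` J))"
  have A': "finite A'" "A' \<subseteq> topspace X" using A J by (auto simp: A'_def)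
  have \<epsilon>: "\<epsilon> > 0" "\<And>y. y \<in> J \<Longrightarrow> \<epsilon> \<le> \<delta> y" using A J by (auto simp: \<epsilon>_def)
  define B where "B = (\<Pi>\<^sub>E x\<in>topspace X. if x \<in> A' then {-\<epsilon><..<\<epsilon>} else UNIV)"
  have "openin (product_topology (\<lambda>_. euclideanreal) (topspace X)) B"
    unfolding B_def
  proof (rule product_topology_basis)
    show "finite {x. (if x \<in> A' then {-\<epsilon><..<\<epsilon>} else UNIV) \<noteq> topspace euclideanreal}"
      by (rule finite_subset[OF _ A'(1)]) auto
  qed auto
  then have V: "openin (Cp X) (B \<inter> {f. continuous_map X euclideanreal f})"
    unfolding Cp_def openin_subtopology by blast
  show "\<exists>V. openin (Cp X) V \<and> Cp_zero X \<in> V \<and>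
      (\<forall>f\<in>topspace (Cp X). \<forall>g\<in>topspace (Cp X). Cp_diff X f g \<in> V \<longrightarrow> Cp_diff Y (\<phi> f) (\<phi> g) \<in> U)"
  proof (intro exI conjI ballI impI)
    show "Cp_zero X \<in> B \<inter> {f. continuous_map X euclideanreal f}"
      using Cp_zero_in[of X] \<epsilon>(1) by (auto simp: B_def Cp_zero_def Cp_def)
    fix f g assume fg: "f \<in> topspace (Cp X)" "g \<in> topspace (Cp X)"
      and "Cp_diff X f g \<in> B \<inter> {f. continuous_map X euclideanreal f}"
    then have "Cp_diff X f g \<in> B" by simp
    have close: "\<bar>f a - g a\<bar> < \<epsilon>" if "a \<in> A'" for a
    proof -
      have "a \<in> topspace X" using that A' by blast
      then have "Cp_diff X f g a \<in> {-\<epsilon><..<\<epsilon>}"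
        using PiE_mem[OF \<open>Cp_diff X f g \<in> B\<close>[unfolded B_def], of a] that by simp
      then show ?thesis using \<open>a \<in> topspace X\<close> by (auto simp: Cp_diff_def)
    qed
    have "\<phi> f y - \<phi> g y \<in> W y" if "y \<in> topspace Y" for y
    proof (cases "y \<in> J")
      case True
      have "\<forall>a\<in>A y. \<bar>f a - g a\<bar> < \<delta> y"
        using close \<epsilon>(2)[OF True] True unfolding A'_def by fastforce
      then show ?thesis using A[OF True] e(2)[OF True] by blast
    next
      case False
      then show ?thesis using that by (simp add: J_def)
    qed
    then have "Cp_diff Y (\<phi> f) (\<phi> g) \<in> (\<Pi>\<^sub>E y\<in>topspace Y. W y)"
      by (auto simp: Cp_diff_def)
    moreover have "continuous_map Y euclideanreal (Cp_diff Y (\<phi> f) (\<phi> g))"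
      using Cp_diff_in[of "\<phi> f" Y "\<phi> g"] maps fg by (auto simp: Cp_def Pi_iff)
    ultimately show "Cp_diff Y (\<phi> f) (\<phi> g) \<in> U" using T(2) W(4) by blast
  qed (rule V)
qed

section \<open>Gluing approximations over a sequence of closed sets\<close>

text \<open>The functions carried by \<open>G\<close>, arranged in a double sequence and normalised so that they tend to zero:
the \<open>n\<close>-th row is used in the \<open>n\<close>-th step of the construction below.\<close>

definition piece :: "(real \<Rightarrow> real) \<Rightarrow> nat \<Rightarrow> nat \<Rightarrow> real \<Rightarrow> real" where
  "piece G n i t = G (piece_point (prod_encode (n, i)) t) - G 0"

lemma continuous_piece:
  assumes G: "continuous_on {0..1} G" shows "continuous_on {0..1} (piece G n i)"
  unfolding piece_def
  by (intro continuous_intros continuous_on_compose2[OF G continuous_piece_point]) (use piece_point_bounds(3) in auto)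

lemma finitely_lipschitz_piece:
  assumes "t \<in> {0..1}" shows "finitely_lipschitz (\<lambda>G. piece G n i t) {0..1}"
  unfolding piece_def by (intro finitely_lipschitz_intros piece_point_bounds(3) assms) auto

lemma piece_small:
  assumes G: "continuous_on {0..1} G" and e: "e > 0"
  shows "\<exists>N. \<forall>n\<ge>N. \<forall>i. \<forall>t\<in>{0..1}. \<bar>piece G n i t\<bar> < e"
proof -
  obtain d where d: "d > 0" "\<And>x. x \<in> {0..1} \<Longrightarrow> \<bar>x\<bar> < d \<Longrightarrow> \<bar>G x - G 0\<bar> < e"
    using G[unfolded continuous_on_iff, rule_format, of 0 e] e by (auto simp: dist_real_def)
  obtain N where N: "1 / real (Suc N) < d" using nat_approx_posE[OF d(1)] by metis
  have "\<bar>piece G n i t\<bar> < e" if "n \<ge> N" "t \<in> {0..1}" for n i t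
  proof -
    let ?k = "prod_encode (n, i)"
    have "N \<le> ?k" using le_prod_encode_1[of n i] that(1) by linarith
    then have "1 / real (?k + 1) \<le> 1 / real (Suc N)" by (simp add: field_simps)
    then have "piece_point ?k t < d" using piece_point_bounds(2)[OF that(2), of ?k] N by linarith
    then show ?thesis unfolding piece_def
      using piece_point_bounds(1,3)[OF that(2), of ?k] by (intro d(2)) auto
  qed
  then show ?thesis by blast
qed

text \<open>A stage consists of an approximation and of a lower and an upper bound for all later
approximations.\<close>

type_synonym 'b stage = "('b \<Rightarrow> real) \<times> ('b \<Rightarrow> real) \<times> ('b \<Rightarrow> real)"

text \<open>The inner functions \<open>\<psi> n i\<close> are defined on all of \<open>S\<close>, so that outer functions determine a continuous
function on \<open>S\<close>, although a prescribed function is represented on \<open>F n\<close> only. The functions \<open>u n\<close> play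
the role of distances from the union of the first \<open>n\<close> sets.\<close>

locale gluing_data =
  fixes S :: "'b::metric_space set" and F :: "nat \<Rightarrow> 'b set"
    and u :: "nat \<Rightarrow> 'b \<Rightarrow> real"
    and N :: "nat \<Rightarrow> nat" and \<psi> :: "nat \<Rightarrow> nat \<Rightarrow> 'b \<Rightarrow> real"
    and m :: "nat \<Rightarrow> nat" and a :: "nat \<Rightarrow> nat \<Rightarrow> 'b" and \<mu> :: "nat \<Rightarrow> nat \<Rightarrow> 'b \<Rightarrow> real"
  assumes S: "compact S" and F: "S = (\<Union>n. F n)"
    and u_cont: "continuous_on S (u n)"
    and u01: "x \<in> S \<Longrightarrow> u n x \<in> {0..1}"
    and u_zero: "x \<in> S \<Longrightarrow> u n x = 0 \<longleftrightarrow> (\<exists>k<n. x \<in> F k)"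
    and \<psi>_cont: "i < N n \<Longrightarrow> continuous_on S (\<psi> n i)"
    and \<psi>01: "i < N n \<Longrightarrow> x \<in> S \<Longrightarrow> \<psi> n i x \<in> {0..1}"
    and superposition: "\<lbrakk>continuous_on S (h :: 'b \<Rightarrow> real); \<And>x. x \<in> S \<Longrightarrow> \<bar>h x\<bar> \<le> B; 0 \<le> B\<rbrakk> \<Longrightarrow>
      \<exists>g. (\<forall>i::nat. continuous_on UNIV (g i)) \<and> (\<forall>i s. \<bar>g i s\<bar> \<le> 2 * B) \<and>
        (\<forall>x\<in>F n. h x = (\<Sum>i<N n. g i (\<psi> n i x)))"
    and a_in: "j < m n \<Longrightarrow> a n j \<in> S" and \<mu>_cont: "j < m n \<Longrightarrow> continuous_on S (\<mu> n j)"
    and averaging: "continuous_on S f \<Longrightarrow> \<exists>\<alpha>. \<alpha> \<longlonglongrightarrow> 0 \<and>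
      (\<forall>n. \<forall>x\<in>S. \<bar>f x - (\<Sum>j<m n. \<mu> n j x * f (a n j))\<bar> \<le> \<alpha> n)"
begin

text \<open>A row \<open>\<gamma>\<close> of functions is read as follows: \<open>\<gamma> 0\<close> bounds all future changes of the approximation as a
function of \<open>u n\<close>, \<open>\<gamma> 1 0\<close> bounds the deviation from the average, the numbers \<open>\<gamma> (2 + 2 * j) 0\<close> are
corrections at the points of the average, and the functions \<open>\<gamma> (3 + 2 * i)\<close> are the outer functions of a
superposition. The difference with \<open>\<gamma> 0 0\<close> makes the radius vanish on \<open>F 0, ..., F (n - 1)\<close> for every
choice of \<open>\<gamma>\<close>.\<close>

definition radius :: "nat \<Rightarrow> (nat \<Rightarrow> real \<Rightarrow> real) \<Rightarrow> 'b \<Rightarrow> real" where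
  "radius n \<gamma> x = \<bar>\<gamma> 0 (u n x) - \<gamma> 0 0\<bar>"

definition average :: "nat \<Rightarrow> (nat \<Rightarrow> real \<Rightarrow> real) \<Rightarrow> ('b \<Rightarrow> real) \<Rightarrow> 'b \<Rightarrow> real" where
  "average n \<gamma> e x = (\<Sum>j<m n. \<mu> n j x * (e (a n j) + \<gamma> (2 + 2 * j) 0))"

text \<open>The superposition is only under control on \<open>F n\<close>; elsewhere the average, whose values depend on
finitely many values of \<open>e\<close>, keeps the new approximation within bounds.\<close>

definition target :: "nat \<Rightarrow> (nat \<Rightarrow> real \<Rightarrow> real) \<Rightarrow> ('b \<Rightarrow> real) \<Rightarrow> 'b \<Rightarrow> real" where
  "target n \<gamma> e x =
     max (average n \<gamma> e x - \<bar>\<gamma> 1 0\<bar>) (min (average n \<gamma> e x + \<bar>\<gamma> 1 0\<bar>)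
       (e x + (\<Sum>i<N n. \<gamma> (3 + 2 * i) (\<psi> n i x))))"

text \<open>The target is truncated to the interval allowed so far, intersected with the interval of the new
radius around the old approximation. The old approximation lies in both, so the intersection is never
empty, whatever \<open>\<gamma>\<close> is.\<close>

definition next_stage :: "nat \<Rightarrow> (nat \<Rightarrow> real \<Rightarrow> real) \<Rightarrow> 'b stage \<Rightarrow> 'b stage" where
  "next_stage n \<gamma> = (\<lambda>(e, lo, hi).
     (\<lambda>x. max (max (lo x) (e x - radius n \<gamma> x)) (min (min (hi x) (e x + radius n \<gamma> x)) (target n \<gamma> e x)),
      \<lambda>x. max (lo x) (e x - radius n \<gamma> x),
      \<lambda>x. min (hi x) (e x + radius n \<gamma> x)))"

primrec stage :: "(real \<Rightarrow> real) \<Rightarrow> nat \<Rightarrow> 'b stage" where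
  "stage G 0 = (\<lambda>x. 0, \<lambda>x. - \<bar>piece G 0 0 0\<bar>, \<lambda>x. \<bar>piece G 0 0 0\<bar>)"
| "stage G (Suc n) = next_stage n (piece G (Suc n)) (stage G n)"

definition appr :: "(real \<Rightarrow> real) \<Rightarrow> nat \<Rightarrow> 'b \<Rightarrow> real" where "appr G n = fst (stage G n)"
definition lower :: "(real \<Rightarrow> real) \<Rightarrow> nat \<Rightarrow> 'b \<Rightarrow> real" where "lower G n = fst (snd (stage G n))"
definition upper :: "(real \<Rightarrow> real) \<Rightarrow> nat \<Rightarrow> 'b \<Rightarrow> real" where "upper G n = snd (snd (stage G n))"

lemma stage_0:
  "appr G 0 x = 0" "lower G 0 x = - \<bar>piece G 0 0 0\<bar>" "upper G 0 x = \<bar>piece G 0 0 0\<bar>"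
  by (simp_all add: appr_def lower_def upper_def)

lemma stage_Suc:
  "lower G (Suc n) x = max (lower G n x) (appr G n x - radius n (piece G (Suc n)) x)"
  "upper G (Suc n) x = min (upper G n x) (appr G n x + radius n (piece G (Suc n)) x)"
  "appr G (Suc n) x = max (lower G (Suc n) x) (min (upper G (Suc n) x) (target n (piece G (Suc n)) (appr G n) x))"
proof -
  obtain e lo hi where st: "stage G n = (e, lo, hi)" by (metis prod_cases3)
  then have "appr G n = e" "lower G n = lo" "upper G n = hi" by (simp_all add: appr_def lower_def upper_def)
  moreover have "stage G (Suc n) = next_stage n (piece G (Suc n)) (e, lo, hi)" by (simp add: st)
  ultimately show
    "lower G (Suc n) x = max (lower G n x) (appr G n x - radius n (piece G (Suc n)) x)"
    "upper G (Suc n) x = min (upper G n x) (appr G n x + radius n (piece G (Suc n)) x)"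
    "appr G (Suc n) x = max (lower G (Suc n) x) (min (upper G (Suc n) x) (target n (piece G (Suc n)) (appr G n) x))"
    unfolding appr_def[of G "Suc n"] lower_def[of G "Suc n"] upper_def[of G "Suc n"] by (simp_all add: next_stage_def)
qed

lemma appr_between: "lower G n x \<le> appr G n x" "appr G n x \<le> upper G n x"
proof -
  have "lower G n x \<le> appr G n x \<and> appr G n x \<le> upper G n x"
  proof (induction n)
    case (Suc n)
    have "0 \<le> radius n (piece G (Suc n)) x" by (simp add: radius_def)
    then have "lower G (Suc n) x \<le> upper G (Suc n) x" using Suc by (simp add: stage_Suc)
    then show ?case unfolding stage_Suc(3) by auto
  qed (simp add: stage_0)
  then show "lower G n x \<le> appr G n x" "appr G n x \<le> upper G n x" by auto
qed

lemma lower_mono: "n \<le> k \<Longrightarrow> lower G n x \<le> lower G k x"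
  by (induction k rule: dec_induct) (auto simp: stage_Suc)

lemma upper_mono: "n \<le> k \<Longrightarrow> upper G k x \<le> upper G n x"
  by (induction k rule: dec_induct) (auto simp: stage_Suc)

lemma appr_cauchy:
  assumes "n \<le> k" shows "\<bar>appr G k x - appr G n x\<bar> \<le> radius n (piece G (Suc n)) x"
proof (cases "k = n")
  case True then show ?thesis by (simp add: radius_def)
next
  case False
  then have "Suc n \<le> k" using assms by simp
  then have "lower G (Suc n) x \<le> appr G k x" "appr G k x \<le> upper G (Suc n) x"
    using lower_mono[of "Suc n" k G x] upper_mono[of "Suc n" k G x] appr_between[of G k x] by linarith+
  then show ?thesis by (auto simp: stage_Suc)
qed

text \<open>The radius of stage \<open>n + 1\<close> vanishes on \<open>F n\<close>, so nothing changes there any more.\<close>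

lemma appr_stable:
  assumes "x \<in> F n" "Suc n \<le> k" shows "appr G k x = appr G (Suc n) x"
proof -
  have "x \<in> S" using F assms by auto
  then have "u (Suc n) x = 0" using u_zero assms by auto
  then show ?thesis using appr_cauchy[OF assms(2), of G x] by (simp add: radius_def)
qed

lemma finitely_lipschitz_stage:
  "x \<in> S \<Longrightarrow> finitely_lipschitz (\<lambda>G. appr G n x) {0..1} \<and>
    finitely_lipschitz (\<lambda>G. lower G n x) {0..1} \<and> finitely_lipschitz (\<lambda>G. upper G n x) {0..1}"
proof (induction n arbitrary: x)
  case 0
  then show ?case unfolding stage_0 by (intro conjI finitely_lipschitz_intros finitely_lipschitz_piece) auto
next
  case (Suc n)
  have rad: "finitely_lipschitz (\<lambda>G. radius n (piece G (Suc n)) x) {0..1}"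
    unfolding radius_def using u01[OF Suc.prems]
    by (intro finitely_lipschitz_abs finitely_lipschitz_diff finitely_lipschitz_piece) auto
  have avg: "finitely_lipschitz (\<lambda>G. average n (piece G (Suc n)) (appr G n) x) {0..1}"
    unfolding average_def using Suc.IH a_in
    by (intro finitely_lipschitz_sum finitely_lipschitz_cmult finitely_lipschitz_add finitely_lipschitz_piece) auto
  have IH: "finitely_lipschitz (\<lambda>G. appr G n x) {0..1}" "finitely_lipschitz (\<lambda>G. lower G n x) {0..1}"
    "finitely_lipschitz (\<lambda>G. upper G n x) {0..1}" using Suc by auto
  have "finitely_lipschitz (\<lambda>G. target n (piece G (Suc n)) (appr G n) x) {0..1}"
    unfolding target_def
    by (intro finitely_lipschitz_max finitely_lipschitz_min finitely_lipschitz_add finitely_lipschitz_diff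
        finitely_lipschitz_abs finitely_lipschitz_sum finitely_lipschitz_piece avg IH)
      (use \<psi>01 Suc.prems in auto)
  then show ?case unfolding stage_Suc
    by (intro conjI finitely_lipschitz_max finitely_lipschitz_min finitely_lipschitz_add finitely_lipschitz_diff IH rad)
qed

lemma continuous_next_stage:
  assumes \<gamma>: "\<And>i. continuous_on {0..1} (\<gamma> i)"
    and st: "continuous_on S e" "continuous_on S lo" "continuous_on S hi"
    and "next_stage n \<gamma> (e, lo, hi) = (e', lo', hi')"
  shows "continuous_on S e'" "continuous_on S lo'" "continuous_on S hi'"
proof -
  have rad: "continuous_on S (radius n \<gamma>)" unfolding radius_def
    by (intro continuous_intros continuous_on_compose2[OF \<gamma> u_cont]) (use u01 in auto)
  have avg: "continuous_on S (average n \<gamma> e)" unfolding average_def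
    using \<mu>_cont by (intro continuous_intros) auto
  have sup: "continuous_on S (\<lambda>x. \<gamma> (3 + 2 * i) (\<psi> n i x))" if "i < N n" for i
    by (rule continuous_on_compose2[OF \<gamma> \<psi>_cont[OF that]]) (use \<psi>01[OF that] in auto)
  have tgt: "continuous_on S (target n \<gamma> e)" unfolding target_def
    by (intro continuous_on_max continuous_on_min continuous_on_add continuous_on_diff
        continuous_on_const continuous_on_sum st avg sup) auto
  show "continuous_on S e'" "continuous_on S lo'" "continuous_on S hi'"
    using assms(5) unfolding next_stage_def
    by (auto intro!: continuous_on_max continuous_on_min continuous_on_add continuous_on_diff st rad tgt)
qed

lemma continuous_appr:
  assumes G: "continuous_on {0..1} G" shows "continuous_on S (appr G n)"
proof -
  have "\<exists>e lo hi. stage G n = (e, lo, hi) \<and> continuous_on S e \<and> continuous_on S lo \<and> continuous_on S hi"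
  proof (induction n)
    case 0
    then show ?case by (auto intro!: continuous_intros)
  next
    case (Suc n)
    then obtain e lo hi where st: "stage G n = (e, lo, hi)" "continuous_on S e" "continuous_on S lo" "continuous_on S hi"
      by blast
    obtain e' lo' hi' where st': "next_stage n (piece G (Suc n)) (e, lo, hi) = (e', lo', hi')"
      by (metis prod_cases3)
    from continuous_next_stage[OF continuous_piece[OF G] st(2-4) st'] show ?case by (simp add: st(1) st')
  qed
  then show ?thesis by (auto simp: appr_def)
qed

definition glue :: "(real \<Rightarrow> real) \<Rightarrow> 'b \<Rightarrow> real" where
  "glue G x = lim (\<lambda>n. appr G n x)"

lemma glue_eq:
  assumes "x \<in> F n" shows "glue G x = appr G (Suc n) x"
proof -
  have "(\<lambda>k. appr G k x) \<longlonglongrightarrow> appr G (Suc n) x"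
    by (intro tendsto_eventually eventually_sequentiallyI[of "Suc n"] appr_stable[OF assms])
  then show ?thesis unfolding glue_def by (rule limI)
qed

lemma finitely_lipschitz_glue:
  assumes "x \<in> S" shows "finitely_lipschitz (\<lambda>G. glue G x) {0..1}"
proof -
  obtain n where "x \<in> F n" using F assms by auto
  then show ?thesis using finitely_lipschitz_stage[OF assms, of "Suc n"] glue_eq by simp
qed

text \<open>The radii tend to zero uniformly on \<open>S\<close>, because the pieces of \<open>G\<close> tend to zero. Therefore the
approximations converge uniformly.\<close>

lemma continuous_glue:
  assumes G: "continuous_on {0..1} G" shows "continuous_on S (glue G)"
proof -
  define r where "r n t = \<bar>piece G (Suc n) 0 t - piece G (Suc n) 0 0\<bar>" for n t
  define b where "b n = (SUP t\<in>{0..1}. r n t)" for n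
  have "continuous_on {0..1} (r n)" for n
    unfolding r_def by (intro continuous_intros continuous_piece G)
  then have bdd: "bdd_above (r n ` {0..1})" for n
    by (intro bounded_imp_bdd_above compact_imp_bounded compact_continuous_image) auto
  have le: "r n t \<le> b n" if "t \<in> {0..1}" for n t
    unfolding b_def by (rule cSUP_upper[OF that bdd])
  have b0: "b \<longlonglongrightarrow> 0"
  proof (rule LIMSEQ_I)
    fix e :: real assume e: "e > 0"
    then have "e/4 > 0" by simp
    from piece_small[OF G this] obtain K where K: "\<forall>n\<ge>K. \<forall>i. \<forall>t\<in>{0..1}. \<bar>piece G n i t\<bar> < e/4"
      by (elim exE) (rule that)
    have "norm (b n - 0) < e" if "n \<ge> K" for n
    proof -
      have "r n t \<le> e/2" if "t \<in> {0..1}" for t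
      proof -
        have "\<bar>piece G (Suc n) 0 t\<bar> < e/4" "\<bar>piece G (Suc n) 0 0\<bar> < e/4" using K \<open>n \<ge> K\<close> that by auto
        then show ?thesis unfolding r_def by linarith
      qed
      then have "b n \<le> e/2" unfolding b_def by (intro cSUP_least) auto
      moreover have "0 \<le> b n" using le[of 0 n] by (simp add: r_def)
      ultimately show ?thesis using e by simp
    qed
    then show "\<exists>no. \<forall>n\<ge>no. norm (b n - 0) < e" by blast
  qed
  have tail: "\<bar>appr G k x - appr G n x\<bar> \<le> b n" if "n \<le> k" "x \<in> S" for n k x
    using appr_cauchy[OF that(1), of G x] le[OF u01[OF that(2)], of n n] unfolding radius_def r_def by linarith
  obtain g where g: "continuous_on S g" "\<And>x. x \<in> S \<Longrightarrow> (\<lambda>n. appr G n x) \<longlonglongrightarrow> g x"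
    by (rule continuous_limit_of_error_bounds[OF continuous_appr[OF G] tail b0], (assumption | rule that)+)
  have "glue G x = g x" if "x \<in> S" for x unfolding glue_def by (rule limI[OF g(2)[OF that]])
  then show ?thesis using g(1) by (simp cong: continuous_on_cong)
qed

end

context gluing_data begin

text \<open>The invariant under which \<open>f\<close> can still be reached: the truncations so far have not excluded it. The
number \<open>D\<close> bounds the correction that remains to be made.\<close>

definition admissible :: "('b \<Rightarrow> real) \<Rightarrow> nat \<Rightarrow> real \<Rightarrow> 'b stage \<Rightarrow> bool" where
  "admissible f n D st \<longleftrightarrow> (case st of (e, lo, hi) \<Rightarrow>
     continuous_on S e \<and> continuous_on S lo \<and> continuous_on S hi \<and>
     (\<forall>k<n. \<forall>x\<in>F k. e x = f x) \<and>
     (\<forall>x\<in>S. lo x \<le> f x \<and> f x \<le> hi x \<and> lo x \<le> e x \<and> e x \<le> hi x \<and> \<bar>f x - e x\<bar> \<le> D))"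

text \<open>Rows of functions are prescribed on the unit interval only, so stages can be compared only on \<open>S\<close>.\<close>

lemma next_stage_cong:
  assumes \<gamma>: "\<And>i t. t \<in> {0..1} \<Longrightarrow> \<gamma> i t = \<gamma>' i t"
    and e: "\<And>x. x \<in> S \<Longrightarrow> e x = e' x \<and> lo x = lo' x \<and> hi x = hi' x" and x: "x \<in> S"
  shows "fst (next_stage n \<gamma> (e, lo, hi)) x = fst (next_stage n \<gamma>' (e', lo', hi')) x"
    "fst (snd (next_stage n \<gamma> (e, lo, hi))) x = fst (snd (next_stage n \<gamma>' (e', lo', hi'))) x"
    "snd (snd (next_stage n \<gamma> (e, lo, hi))) x = snd (snd (next_stage n \<gamma>' (e', lo', hi'))) x"
proof -
  have rad: "radius n \<gamma> x = radius n \<gamma>' x"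
    using u01[OF x, of n] by (simp add: radius_def \<gamma>)
  have avg: "average n \<gamma> e x = average n \<gamma>' e' x"
    unfolding average_def using a_in e by (intro sum.cong) (auto simp: \<gamma>)
  have "(\<Sum>i<N n. \<gamma> (3 + 2 * i) (\<psi> n i x)) = (\<Sum>i<N n. \<gamma>' (3 + 2 * i) (\<psi> n i x))"
    using \<psi>01[OF _ x] by (intro sum.cong refl \<gamma>) auto
  then have "target n \<gamma> e x = target n \<gamma>' e' x"
    using e[OF x] by (simp add: target_def avg \<gamma>)
  with rad e[OF x] show
    "fst (next_stage n \<gamma> (e, lo, hi)) x = fst (next_stage n \<gamma>' (e', lo', hi')) x"
    "fst (snd (next_stage n \<gamma> (e, lo, hi))) x = fst (snd (next_stage n \<gamma>' (e', lo', hi'))) x"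
    "snd (snd (next_stage n \<gamma> (e, lo, hi))) x = snd (snd (next_stage n \<gamma>' (e', lo', hi'))) x"
    by (simp_all add: next_stage_def)
qed

text \<open>With \<open>h = f - e\<close>, take for \<open>\<gamma>\<close> a majorant of \<open>\<bar>h\<bar>\<close> in terms of \<open>u n\<close>, the error \<open>\<alpha>\<close> of averaging \<open>f\<close>, the
values of \<open>h\<close> at the points of the average, and a superposition representing \<open>h\<close> on \<open>F n\<close>. The new average
is then the average of \<open>f\<close> itself, so the new distance from \<open>f\<close> depends on \<open>\<alpha>\<close> only and not on \<open>D\<close>,
while \<open>\<gamma>\<close> is controlled by \<open>D\<close> and \<open>\<alpha>\<close>: this is why the rows chosen for a fixed \<open>f\<close> tend to zero.\<close>

lemma admissible_next:
  assumes f: "continuous_on S f"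
    and \<alpha>: "\<And>x. x \<in> S \<Longrightarrow> \<bar>f x - (\<Sum>j<m n. \<mu> n j x * f (a n j))\<bar> \<le> \<alpha>" "0 \<le> \<alpha>"
    and D: "0 \<le> D" and st: "admissible f n D st"
  shows "\<exists>\<gamma>. (\<forall>i. continuous_on {0..1} (\<gamma> i)) \<and> (\<forall>i. \<forall>t\<in>{0..1}. \<bar>\<gamma> i t\<bar> \<le> 2 * D + \<alpha>) \<and>
    (\<exists>K. \<forall>i\<ge>K. \<gamma> i = (\<lambda>_. 0)) \<and> admissible f (Suc n) (2 * \<alpha>) (next_stage n \<gamma> st)"
proof -
  obtain e lo hi where st_eq: "st = (e, lo, hi)" by (metis prod_cases3)
  have cont: "continuous_on S e" "continuous_on S lo" "continuous_on S hi"
    and agree: "\<And>k x. k < n \<Longrightarrow> x \<in> F k \<Longrightarrow> e x = f x"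
    and bnd: "\<And>x. x \<in> S \<Longrightarrow> lo x \<le> f x \<and> f x \<le> hi x \<and> lo x \<le> e x \<and> e x \<le> hi x \<and> \<bar>f x - e x\<bar> \<le> D"
    using st unfolding admissible_def st_eq by auto
  define h where "h x = f x - e x" for x
  have h_cont: "continuous_on S h" unfolding h_def by (intro continuous_intros f cont)
  have h_le: "\<bar>h x\<bar> \<le> D" if "x \<in> S" for x using bnd[OF that] by (simp add: h_def)
  have h_zero: "h x = 0" if "x \<in> S" "u n x = 0" for x
    using u_zero[OF that(1), of n] that(2) agree by (auto simp: h_def)
  obtain \<zeta> where \<zeta>: "continuous_on {0..1} \<zeta>" "\<zeta> 0 = 0" "\<And>t. t \<in> {0..1} \<Longrightarrow> 0 \<le> \<zeta> t \<and> \<zeta> t \<le> D"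
    "\<And>x. x \<in> S \<Longrightarrow> \<bar>h x\<bar> \<le> \<zeta> (u n x)"
  proof -
    have "\<exists>\<zeta>. continuous_on {0..1::real} \<zeta> \<and> \<zeta> 0 = 0 \<and> (\<forall>t\<in>{0..1}. 0 \<le> \<zeta> t \<and> \<zeta> t \<le> D) \<and> (\<forall>x\<in>S. \<bar>h x\<bar> \<le> \<zeta> (u n x))"
      by (rule continuous_majorant_along_function[OF S h_cont u_cont _ h_zero h_le D]) (use u01 in auto)
    then show ?thesis using that by blast
  qed
  obtain g where g: "\<And>i::nat. continuous_on UNIV (g i)" "\<And>i s. \<bar>g i s\<bar> \<le> 2 * D"
    "\<And>x. x \<in> F n \<Longrightarrow> h x = (\<Sum>i<N n. g i (\<psi> n i x))"
    using superposition[OF h_cont h_le D, of n] by blast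
  \<comment> \<open>Rows are finite, that is, zero from some index on, so that only finitely many pieces exceed a given size.\<close>
  define \<gamma> where "\<gamma> i = (if i = 0 then \<zeta> else if i = 1 then (\<lambda>_. \<alpha>)
      else if even i then (\<lambda>_. if (i - 2) div 2 < m n then h (a n ((i - 2) div 2)) else 0)
      else if (i - 3) div 2 < N n then g ((i - 3) div 2) else (\<lambda>_. 0))" for i
  have \<gamma>01: "\<gamma> 0 = \<zeta>" "\<gamma> 1 = (\<lambda>_. \<alpha>)" by (simp_all add: \<gamma>_def)
  have \<gamma>_even: "\<gamma> (2 + 2 * j) = (\<lambda>_. h (a n j))" if "j < m n" for j
    using that by (simp add: \<gamma>_def)
  have \<gamma>_odd: "\<gamma> (3 + 2 * i) = g i" if "i < N n" for i
    using that by (simp add: \<gamma>_def)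
  have "continuous_on {0..1} (\<gamma> i)" for i
    using \<zeta>(1) g(1) by (auto simp: \<gamma>_def intro: continuous_on_subset)
  moreover have "\<bar>\<gamma> i t\<bar> \<le> 2 * D + \<alpha>" if t: "t \<in> {0..1}" for i t
  proof -
    have "\<bar>\<zeta> t\<bar> \<le> 2 * D + \<alpha>" using \<zeta>(3)[OF t] D \<alpha>(2) by simp
    moreover have "\<bar>h (a n j)\<bar> \<le> 2 * D + \<alpha>" if "j < m n" for j
      using h_le[OF a_in[OF that]] D \<alpha>(2) by linarith
    moreover have "\<bar>g i t\<bar> \<le> 2 * D + \<alpha>" for i using g(2)[of i t] \<alpha>(2) by linarith
    ultimately show ?thesis using D \<alpha>(2) by (simp add: \<gamma>_def)
  qed
  moreover have "\<exists>K. \<forall>i\<ge>K. \<gamma> i = (\<lambda>_. 0)"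
  proof (intro exI allI impI)
    fix i assume i: "2 * m n + 2 * N n + 4 \<le> i"
    then have "i \<noteq> 0" "i \<noteq> 1" "\<not> (i - 2) div 2 < m n" "\<not> (i - 3) div 2 < N n" by auto
    then show "\<gamma> i = (\<lambda>_. 0)" by (simp add: \<gamma>_def)
  qed
  moreover have "admissible f (Suc n) (2 * \<alpha>) (next_stage n \<gamma> st)"
  proof -
    obtain e' lo' hi' where st': "next_stage n \<gamma> (e, lo, hi) = (e', lo', hi')" by (metis prod_cases3)
    have eqs: "lo' x = max (lo x) (e x - radius n \<gamma> x)" "hi' x = min (hi x) (e x + radius n \<gamma> x)"
      "e' x = max (lo' x) (min (hi' x) (target n \<gamma> e x))" for x
      using st' by (auto simp: next_stage_def)
    have "continuous_on S e'" "continuous_on S lo'" "continuous_on S hi'"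
      using continuous_next_stage[OF \<open>\<And>i. continuous_on {0..1} (\<gamma> i)\<close> cont st'] by auto
    moreover have main: "lo' x \<le> f x \<and> f x \<le> hi' x \<and> lo' x \<le> e' x \<and> e' x \<le> hi' x \<and> \<bar>f x - e' x\<bar> \<le> 2 * \<alpha>"
      and e'_agree: "(\<exists>k<Suc n. x \<in> F k) \<Longrightarrow> e' x = f x" if x: "x \<in> S" for x
    proof -
      have rad: "radius n \<gamma> x = \<zeta> (u n x)"
        unfolding radius_def \<gamma>01 using \<zeta>(2) \<zeta>(3)[OF u01[OF x]] by simp
      have "\<bar>f x - e x\<bar> \<le> radius n \<gamma> x" using \<zeta>(4)[OF x] rad by (simp add: h_def)
      then have lohi: "lo' x \<le> f x" "f x \<le> hi' x" unfolding eqs(1,2) using bnd[OF x] by auto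
      have avg: "average n \<gamma> e x = (\<Sum>j<m n. \<mu> n j x * f (a n j))"
        unfolding average_def by (intro sum.cong) (auto simp: \<gamma>_even[simplified] h_def)
      have close: "\<bar>f x - average n \<gamma> e x\<bar> \<le> \<alpha>" using \<alpha>(1)[OF x] avg by simp
      have "\<bar>target n \<gamma> e x - average n \<gamma> e x\<bar> \<le> \<alpha>"
        unfolding target_def \<gamma>01 using \<alpha>(2) by linarith
      then have t_close: "\<bar>f x - target n \<gamma> e x\<bar> \<le> 2 * \<alpha>" using close by linarith
      show "lo' x \<le> f x \<and> f x \<le> hi' x \<and> lo' x \<le> e' x \<and> e' x \<le> hi' x \<and> \<bar>f x - e' x\<bar> \<le> 2 * \<alpha>"
        using lohi t_close unfolding eqs(3) by linarith
      assume "\<exists>k<Suc n. x \<in> F k"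
      then consider "x \<in> F n" | "\<exists>k<n. x \<in> F k" using less_Suc_eq by auto
      then show "e' x = f x"
      proof cases
        case 1
        have "(\<Sum>i<N n. \<gamma> (3 + 2 * i) (\<psi> n i x)) = h x"
          unfolding g(3)[OF 1] by (intro sum.cong refl) (simp add: \<gamma>_odd[simplified])
        then have "e x + (\<Sum>i<N n. \<gamma> (3 + 2 * i) (\<psi> n i x)) = f x" by (simp add: h_def)
        then have "target n \<gamma> e x = f x" unfolding target_def \<gamma>01 using close by auto
        then show ?thesis unfolding eqs(3) using lohi by auto
      next
        case 2
        then have "radius n \<gamma> x = 0" "e x = f x"
          using rad \<zeta>(2) u_zero[OF x, of n] agree by auto
        then show ?thesis using bnd[OF x] unfolding eqs by auto
      qed
    qed
    moreover have "x \<in> S" if "x \<in> F k" for k x using F that by auto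
    ultimately show ?thesis unfolding st_eq st' admissible_def by (simp add: less_Suc_eq) blast
  qed
  ultimately show ?thesis by blast
qed

text \<open>The rows for \<open>f\<close> are chosen one after another, each for the stage produced by the previous ones.
Row 0 only carries the bound \<open>M\<close> of \<open>f\<close> that starts the construction. All rows together are the pieces
of one function \<open>G\<close>.\<close>

lemma glue_surj:
  assumes f: "continuous_on S f"
  shows "\<exists>G. continuous_on {0..1} G \<and> (\<forall>x\<in>S. glue G x = f x)"
proof -
  obtain \<alpha>0 where \<alpha>0: "\<alpha>0 \<longlonglongrightarrow> 0" "\<And>n x. x \<in> S \<Longrightarrow> \<bar>f x - (\<Sum>j<m n. \<mu> n j x * f (a n j))\<bar> \<le> \<alpha>0 n"
    using averaging[OF f] by blast
  define \<alpha> where "\<alpha> n = \<bar>\<alpha>0 n\<bar>" for n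
  have \<alpha>: "\<alpha> \<longlonglongrightarrow> 0" "\<And>n x. x \<in> S \<Longrightarrow> \<bar>f x - (\<Sum>j<m n. \<mu> n j x * f (a n j))\<bar> \<le> \<alpha> n" "\<And>n. 0 \<le> \<alpha> n"
    using tendsto_rabs_zero[OF \<alpha>0(1)] order_trans[OF \<alpha>0(2) abs_ge_self] by (simp_all add: \<alpha>_def[abs_def])
  have "bounded (f ` S)" using compact_continuous_image[OF f S] by (rule compact_imp_bounded)
  then obtain M where M: "M > 0" "\<And>x. x \<in> S \<Longrightarrow> \<bar>f x\<bar> \<le> M"
    by (auto simp: bounded_pos)
  define D where "D n = (case n of 0 \<Rightarrow> M | Suc k \<Rightarrow> 2 * \<alpha> k)" for n
  have D: "0 \<le> D n" "D (Suc n) = 2 * \<alpha> n" "D 0 = M" for n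
    using M \<alpha>(3) by (auto simp: D_def split: nat.split)
  define good where "good n st \<gamma> \<longleftrightarrow> (\<forall>i. continuous_on {0..1} (\<gamma> i)) \<and> (\<forall>i. \<forall>t\<in>{0..1}. \<bar>\<gamma> i t\<bar> \<le> 2 * D n + \<alpha> n) \<and>
    (\<exists>K. \<forall>i\<ge>K. \<gamma> i = (\<lambda>_. 0)) \<and> admissible f (Suc n) (D (Suc n)) (next_stage n \<gamma> st)"
    for n st and \<gamma> :: "nat \<Rightarrow> real \<Rightarrow> real"
  have "\<exists>\<gamma>. good n st \<gamma>" if "admissible f n (D n) st" for n st
    unfolding good_def D(2) using admissible_next[OF f \<alpha>(2)[of _ n] \<alpha>(3) D(1) that] by simp
  then obtain \<Gamma> where \<Gamma>: "\<And>n st. admissible f n (D n) st \<Longrightarrow> good n st (\<Gamma> n st)" by metis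
  define st where "st = rec_nat (\<lambda>x. 0, \<lambda>x. - M, \<lambda>x. M) (\<lambda>n st. next_stage n (\<Gamma> n st) st)"
  have st: "st 0 = (\<lambda>x. 0, \<lambda>x. - M, \<lambda>x. M)" "\<And>n. st (Suc n) = next_stage n (\<Gamma> n (st n)) (st n)"
    by (simp_all add: st_def)
  have adm: "admissible f n (D n) (st n)" for n
  proof (induction n)
    case 0
    then show ?case using M by (auto simp: admissible_def st D abs_le_iff) (use minus_le_iff in blast)
  next
    case (Suc n)
    then show ?case using \<Gamma>[of n "st n"] unfolding good_def st by blast
  qed
  then have good: "good n (st n) (\<Gamma> n (st n))" for n using \<Gamma> by blast
  define \<gamma> where "\<gamma> n i = (case n of 0 \<Rightarrow> (if i = 0 then (\<lambda>_. M) else (\<lambda>_. 0)) | Suc k \<Rightarrow> \<Gamma> k (st k) i)" for n i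
  obtain G where G: "continuous_on {0..1} G" "G 0 = 0"
    "\<And>k t. t \<in> {0..1} \<Longrightarrow> G (piece_point k t) = \<gamma> (fst (prod_decode k)) (snd (prod_decode k)) t"
  proof (rule continuous_function_with_prescribed_pieces[of "\<lambda>k. \<gamma> (fst (prod_decode k)) (snd (prod_decode k))"])
    show "continuous_on {0..1} (\<gamma> (fst (prod_decode k)) (snd (prod_decode k)))" for k
      using good by (auto simp: \<gamma>_def good_def split: nat.split)
    fix e :: real assume e: "e > 0"
    have "(\<lambda>n. 2 * D (Suc n) + \<alpha> (Suc n)) \<longlonglongrightarrow> 2 * (2 * 0) + 0"
      unfolding D(2) by (intro tendsto_intros \<alpha>(1) LIMSEQ_Suc)
    then have "(\<lambda>n. 2 * D (Suc n) + \<alpha> (Suc n)) \<longlonglongrightarrow> 0" by simp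
    then have "\<forall>\<^sub>F n in sequentially. 2 * D (Suc n) + \<alpha> (Suc n) < e"
      using e by (rule order_tendstoD(2))
    then obtain L where L: "\<And>n. n \<ge> L \<Longrightarrow> 2 * D (Suc n) + \<alpha> (Suc n) < e"
      unfolding eventually_sequentially by blast
    have "\<exists>K. \<forall>i\<ge>K. \<gamma> n i = (\<lambda>_. 0)" for n
    proof (cases n)
      case 0
      then show ?thesis by (intro exI[of _ 1]) (auto simp: \<gamma>_def)
    next
      case (Suc k)
      then show ?thesis using good[of k] by (simp add: \<gamma>_def good_def)
    qed
    then obtain K where K: "\<And>n i. i \<ge> K n \<Longrightarrow> \<gamma> n i = (\<lambda>_. 0)" by metis
    have "{k. \<exists>t\<in>{0..1}. \<bar>\<gamma> (fst (prod_decode k)) (snd (prod_decode k)) t\<bar> \<ge> e}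
        \<subseteq> prod_encode ` (Sigma {..L + 1} (\<lambda>n. {..<K n}))"
    proof clarify
      fix k t assume t: "t \<in> {0..1::real}" and ge: "e \<le> \<bar>\<gamma> (fst (prod_decode k)) (snd (prod_decode k)) t\<bar>"
      obtain n i where ni: "prod_decode k = (n, i)" by (metis surj_pair)
      have ge: "e \<le> \<bar>\<gamma> n i t\<bar>" using ge ni by simp
      have "i < K n"
      proof (rule ccontr)
        assume "\<not> i < K n"
        then show False using K[of n i] ge e by simp
      qed
      moreover have "n \<le> L + 1"
      proof (rule ccontr)
        assume "\<not> n \<le> L + 1"
        then obtain p where p: "n = Suc (Suc p)" "L \<le> p" by (metis Suc_eq_plus1 Suc_le_D not_less_eq_eq Suc_le_mono)
        have "\<bar>\<gamma> n i t\<bar> \<le> 2 * D (Suc p) + \<alpha> (Suc p)"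
          using good[of "Suc p"] t unfolding good_def p(1) \<gamma>_def by simp
        then show False using L[OF p(2)] ge by linarith
      qed
      ultimately have "(n, i) \<in> Sigma {..L + 1} (\<lambda>n. {..<K n})" by simp
      moreover have "k = prod_encode (n, i)" using ni by (metis prod_decode_inverse)
      ultimately show "k \<in> prod_encode ` (Sigma {..L + 1} (\<lambda>n. {..<K n}))" by blast
    qed
    then show "finite {k. \<exists>t\<in>{0..1}. \<bar>\<gamma> (fst (prod_decode k)) (snd (prod_decode k)) t\<bar> \<ge> e}"
      by (rule finite_subset) auto
  qed (rule that)
  have piece: "piece G n i t = \<gamma> n i t" if "t \<in> {0..1}" for n i t
    using G(2) G(3)[OF that, of "prod_encode (n, i)"] by (simp add: piece_def)
  have stage: "\<forall>x\<in>S. appr G n x = fst (st n) x \<and> lower G n x = fst (snd (st n)) x \<and> upper G n x = snd (snd (st n)) x" for n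
  proof (induction n)
    case 0
    then show ?case using M piece[of 0 0 0] by (simp add: stage_0 st \<gamma>_def)
  next
    case (Suc n)
    have "piece G (Suc n) i t = \<Gamma> n (st n) i t" if "t \<in> {0..1}" for i t
      using piece[OF that] by (simp add: \<gamma>_def)
    from next_stage_cong[OF this, where n = n and e = "appr G n" and e' = "fst (st n)" and lo = "lower G n"
        and lo' = "fst (snd (st n))" and hi = "upper G n" and hi' = "snd (snd (st n))"]
    show ?case using Suc by (simp add: st(2) appr_def lower_def upper_def)
  qed
  have "glue G x = f x" if x: "x \<in> S" for x
  proof -
    obtain n where n: "x \<in> F n" using F x by auto
    have "fst (st (Suc n)) x = f x"
      using adm[of "Suc n"] n unfolding admissible_def by (auto split: prod.splits)
    then show ?thesis using glue_eq[OF n] stage x by simp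
  qed
  with G(1) show ?thesis by blast
qed

end

text \<open>The inner functions of the superposition on \<open>F n\<close> are extended to \<open>S\<close> by Tietze's theorem.\<close>

lemma existence_of_gluing:
  fixes S :: "'b::{metric_space,second_countable_topology} set" and F :: "nat \<Rightarrow> 'b set"
  assumes S: "compact S" and F: "S = (\<Union>n. F n)" and clF: "\<And>n. closed (F n)"
    and dim: "\<And>n. finite_dimensional (top_of_set (F n))"
  obtains \<Phi> :: "(real \<Rightarrow> real) \<Rightarrow> 'b \<Rightarrow> real" where
    "\<And>G. continuous_on {0..1} G \<Longrightarrow> continuous_on S (\<Phi> G)"
    "\<And>f. continuous_on S f \<Longrightarrow> \<exists>G. continuous_on {0..1} G \<and> (\<forall>x\<in>S. \<Phi> G x = f x)"
    "\<And>x. x \<in> S \<Longrightarrow> finitely_lipschitz (\<lambda>G. \<Phi> G x) {0..1}"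
proof -
  define Z where "Z n = (\<Union>k<n. F k)" for n
  define u where "u n x = (if Z n = {} then 1 else min 1 (infdist x (Z n)))" for n x
  have u_cont: "continuous_on S (u n)" for n
    by (cases "Z n = {}") (auto simp: u_def[abs_def] intro!: continuous_intros)
  have u_zero: "u n x = 0 \<longleftrightarrow> (\<exists>k<n. x \<in> F k)" for n x
  proof (cases "Z n = {}")
    case True
    then show ?thesis by (auto simp: u_def Z_def)
  next
    case False
    have "closed (Z n)" using clF by (auto simp: Z_def)
    then have "x \<in> Z n \<longleftrightarrow> infdist x (Z n) = 0" using False by (rule in_closed_iff_infdist_zero)
    then show ?thesis using False by (auto simp: u_def Z_def min_def)
  qed
  have FS: "F n \<subseteq> S" for n using F by auto
  define super where "super n N \<psi> \<longleftrightarrow> (\<forall>i<N. continuous_on S (\<psi> i) \<and> \<psi> i ` S \<subseteq> {0..1::real}) \<and>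
    (\<forall>(h::'b \<Rightarrow> real) B. continuous_on S h \<and> (\<forall>x\<in>S. \<bar>h x\<bar> \<le> B) \<and> B \<ge> 0 \<longrightarrow>
      (\<exists>g. (\<forall>i::nat. continuous_on UNIV (g i)) \<and> (\<forall>i s. \<bar>g i s\<bar> \<le> 2 * B) \<and>
        (\<forall>x\<in>F n. h x = (\<Sum>i<N. g i (\<psi> i x)))))" for n N \<psi>
  have "\<exists>N \<psi>. super n N \<psi>" for n
  proof -
    have "compact (F n)" using compact_Int_closed[OF S clF[of n]] FS[of n] by (simp add: Int_absorb1)
    from kolmogorov_superposition[OF this dim] obtain N \<psi>0 where
      \<psi>0: "\<forall>i<N. continuous_on (F n) (\<psi>0 i) \<and> \<psi>0 i ` F n \<subseteq> {0..1::real}"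
      and sup: "\<forall>(h::'b \<Rightarrow> real) B. continuous_on (F n) h \<and> (\<forall>x\<in>F n. \<bar>h x\<bar> \<le> B) \<and> B \<ge> 0 \<longrightarrow>
        (\<exists>g. (\<forall>i::nat. continuous_on UNIV (g i)) \<and> (\<forall>i s. \<bar>g i s\<bar> \<le> 2 * B) \<and>
        (\<forall>x\<in>F n. h x = (\<Sum>i<N. g i (\<psi>0 i x))))"
      by (elim exE conjE) (rule that)
    have cl: "closedin (top_of_set S) (F n)" using clF FS by (simp add: closed_subset)
    have "\<exists>\<phi>. continuous_on S \<phi> \<and> \<phi> ` S \<subseteq> {0..1::real} \<and> (\<forall>x\<in>F n. \<phi> x = \<psi>0 i x)" if "i < N" for i
    proof -
      have 1: "continuous_on (F n) (\<psi>0 i)" "\<psi>0 i ` F n \<subseteq> {0..1}" using \<psi>0 that by auto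
      then have 2: "\<And>x. x \<in> F n \<Longrightarrow> \<psi>0 i x \<in> cbox 0 1" unfolding image_subset_iff by simp
      show ?thesis
      proof (rule Tietze_closed_interval_1[OF 1(1) cl zero_le_one 2])
        fix g assume "continuous_on S g" "\<And>x. x \<in> F n \<Longrightarrow> g x = \<psi>0 i x" "\<And>x. x \<in> S \<Longrightarrow> g x \<in> cbox 0 1"
        then show ?thesis by (intro exI[of _ g]) auto
      qed
    qed
    then obtain \<psi> where \<psi>: "\<And>i. i < N \<Longrightarrow> continuous_on S (\<psi> i) \<and> \<psi> i ` S \<subseteq> {0..1::real} \<and> (\<forall>x\<in>F n. \<psi> i x = \<psi>0 i x)"
      by metis
    show ?thesis unfolding super_def
    proof (rule exI[of _ N], rule exI[of _ \<psi>], intro conjI allI impI; (elim conjE)?)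
      fix h :: "'b \<Rightarrow> real" and B
      assume h: "continuous_on S h" "\<forall>x\<in>S. \<bar>h x\<bar> \<le> B" "0 \<le> B"
      then have hF: "continuous_on (F n) h \<and> (\<forall>x\<in>F n. \<bar>h x\<bar> \<le> B) \<and> B \<ge> 0"
        using FS[of n] continuous_on_subset[of S h "F n"] by auto
      obtain g where g: "\<forall>i::nat. continuous_on UNIV (g i)" "\<forall>i s. \<bar>g i s\<bar> \<le> 2 * B"
        "\<forall>x\<in>F n. h x = (\<Sum>i<N. g i (\<psi>0 i x))"
        using sup[THEN spec, THEN spec, THEN mp, OF hF] by (elim exE conjE) (rule that)
      have "\<forall>x\<in>F n. h x = (\<Sum>i<N. g i (\<psi> i x))" using g(3) \<psi> by simp
      with g(1,2) show "\<exists>g. (\<forall>i::nat. continuous_on UNIV (g i)) \<and> (\<forall>i s. \<bar>g i s\<bar> \<le> 2 * B) \<and>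
        (\<forall>x\<in>F n. h x = (\<Sum>i<N. g i (\<psi> i x)))" by blast
    next
      show "continuous_on S (\<psi> i)" "\<psi> i ` S \<subseteq> {0..1}" if "i < N" for i using \<psi>[OF that] by auto
    qed
  qed
  then obtain N \<psi> where super: "\<And>n. super n (N n) (\<psi> n)" by metis
  note \<psi> = super[unfolded super_def]
  obtain m :: "nat \<Rightarrow> nat" and a \<mu> where am: "\<forall>n. \<forall>j<m n. a n j \<in> S \<and> continuous_on S (\<mu> n j)"
    and avg: "\<forall>f::'b \<Rightarrow> real. continuous_on S f \<longrightarrow>
      (\<exists>\<alpha>. \<alpha> \<longlonglongrightarrow> 0 \<and> (\<forall>n. \<forall>x\<in>S. \<bar>f x - (\<Sum>j<m n. \<mu> n j x * f (a n j))\<bar> \<le> \<alpha> n))"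
    using finite_averaging_operators[OF S] by (elim exE conjE) (rule that)
  interpret gluing_data S F u N \<psi> m a \<mu>
  proof
    show "compact S" by (rule S)
    show "S = (\<Union>n. F n)" by (rule F)
    show "continuous_on S (u n)" for n by (rule u_cont)
    show "u n x = 0 \<longleftrightarrow> (\<exists>k<n. x \<in> F k)" for n x by (rule u_zero)
    show "continuous_on S (\<psi> n i)" if "i < N n" for n i using \<psi>[of n] that by blast
    show "\<psi> n i x \<in> {0..1}" if "i < N n" "x \<in> S" for n i x
      using \<psi>[of n] that unfolding image_subset_iff by blast
    show "a n j \<in> S" "continuous_on S (\<mu> n j)" if "j < m n" for n j using am that by auto
    show "u n x \<in> {0..1}" for n x by (auto simp: u_def infdist_nonneg)
    show "\<exists>g. (\<forall>i::nat. continuous_on UNIV (g i)) \<and> (\<forall>i s. \<bar>g i s\<bar> \<le> 2 * B) \<and>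
        (\<forall>x\<in>F n. h x = (\<Sum>i<N n. g i (\<psi> n i x)))"
      if "continuous_on S h" "\<And>x. x \<in> S \<Longrightarrow> \<bar>h x\<bar> \<le> B" "0 \<le> B" for n B and h :: "'b \<Rightarrow> real"
    proof -
      have "continuous_on S h \<and> (\<forall>x\<in>S. \<bar>h x\<bar> \<le> B) \<and> B \<ge> 0" using that by auto
      then show ?thesis by (rule \<psi>[of n, THEN conjunct2, THEN spec, THEN spec, THEN mp])
    qed
    show "\<exists>\<alpha>. \<alpha> \<longlonglongrightarrow> 0 \<and> (\<forall>n. \<forall>x\<in>S. \<bar>f x - (\<Sum>j<m n. \<mu> n j x * f (a n j))\<bar> \<le> \<alpha> n)"
      if "continuous_on S f" for f
      using that by (rule avg[THEN spec, THEN mp])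
  qed
  show ?thesis
    using continuous_glue glue_surj finitely_lipschitz_glue by (rule that)
qed

section \<open>Passage to compact metrizable spaces\<close>

lemma covering_dim_le_homeomorphic_map:
  assumes hom: "homeomorphic_map X Y h" and X: "covering_dim_le X n"
  shows "covering_dim_le Y n"
  unfolding covering_dim_le_def
proof (intro allI impI, elim conjE)
  fix \<U> assume \<U>: "finite \<U>" "open_cover Y \<U>"
  note inj = homeomorphic_imp_injective_map[OF hom] and im = homeomorphic_imp_surjective_map[OF hom]
    and cont = homeomorphic_imp_continuous_map[OF hom] and op = homeomorphic_imp_open_map[OF hom]
  define \<U>' where "\<U>' = (\<lambda>U. {x\<in>topspace X. h x \<in> U}) ` \<U>"
  have "open_cover X \<U>'"
    unfolding open_cover_def
  proof (intro conjI ballI)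
    show "openin X U'" if "U' \<in> \<U>'" for U'
      using that \<U>(2) cont by (auto simp: \<U>'_def open_cover_def openin_continuous_map_preimage)
    show "\<Union>\<U>' = topspace X"
    proof
      show "topspace X \<subseteq> \<Union>\<U>'"
      proof
        fix x assume x: "x \<in> topspace X"
        then have "h x \<in> \<Union>\<U>" using im \<U>(2) by (auto simp: open_cover_def)
        then show "x \<in> \<Union>\<U>'" using x by (auto simp: \<U>'_def)
      qed
    qed (auto simp: \<U>'_def)
  qed
  moreover have "finite \<U>'" using \<U>(1) by (simp add: \<U>'_def)
  ultimately obtain \<V> where \<V>: "finite \<V>" "open_cover X \<V>" "\<forall>V\<in>\<V>. \<exists>U\<in>\<U>'. V \<subseteq> U"
    "\<forall>x\<in>topspace X. card {V \<in> \<V>. x \<in> V} \<le> n + 1"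
    using X unfolding covering_dim_le_def by meson
  have sub: "V \<subseteq> topspace X" if "V \<in> \<V>" for V using \<V>(2) that by (auto simp: open_cover_def)
  show "\<exists>\<V>. finite \<V> \<and> open_cover Y \<V> \<and> (\<forall>V\<in>\<V>. \<exists>U\<in>\<U>. V \<subseteq> U) \<and>
      (\<forall>x\<in>topspace Y. card {V \<in> \<V>. x \<in> V} \<le> n + 1)"
  proof (intro exI[of _ "(`) h ` \<V>"] conjI ballI)
    show "open_cover Y ((`) h ` \<V>)"
      unfolding open_cover_def
    proof (intro conjI ballI)
      show "openin Y W" if "W \<in> (`) h ` \<V>" for W
        using that op \<V>(2) by (auto simp: open_map_def open_cover_def)
      have "\<Union>((`) h ` \<V>) = h ` \<Union>\<V>" by blast
      then show "\<Union>((`) h ` \<V>) = topspace Y" using \<V>(2) im by (simp add: open_cover_def)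
    qed
    show "\<exists>U\<in>\<U>. W \<subseteq> U" if "W \<in> (`) h ` \<V>" for W
    proof -
      obtain V U where "W = h ` V" "V \<in> \<V>" "U \<in> \<U>" "V \<subseteq> {x \<in> topspace X. h x \<in> U}"
        using \<open>W \<in> (`) h ` \<V>\<close> \<V>(3) unfolding \<U>'_def by auto
      then show ?thesis by (intro bexI[of _ U]) auto
    qed
    show "card {W \<in> (`) h ` \<V>. y \<in> W} \<le> n + 1" if y: "y \<in> topspace Y" for y
    proof -
      obtain x where x: "x \<in> topspace X" "y = h x" using im y by blast
      have "{W \<in> (`) h ` \<V>. y \<in> W} \<subseteq> (`) h ` {V \<in> \<V>. x \<in> V}"
      proof (rule subsetI)
        fix W assume "W \<in> {W \<in> (`) h ` \<V>. y \<in> W}"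
        then obtain V where V: "W = h ` V" "V \<in> \<V>" "y \<in> h ` V" by blast
        then obtain x' where "x' \<in> V" "h x' = h x" using x(2) by auto
        then have "x \<in> V" using inj_onD[OF inj, of x' x] sub[OF V(2)] x(1) by auto
        then show "W \<in> (`) h ` {V \<in> \<V>. x \<in> V}" using V by simp
      qed
      then have "card {W \<in> (`) h ` \<V>. y \<in> W} \<le> card ((`) h ` {V \<in> \<V>. x \<in> V})"
        by (intro card_mono) (use \<V>(1) in auto)
      also have "\<dots> \<le> card {V \<in> \<V>. x \<in> V}" by (intro card_image_le) (use \<V>(1) in auto)
      finally show ?thesis using \<V>(4) x(1) by (meson order_trans)
    qed
  qed (use \<V>(1) in auto)
qed

text \<open>A point is determined by its distances from a countable dense set. This brings \<open>K\<close> into a type that is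
a metric space.\<close>

lemma compact_metrizable_embeds_in_sequences:
  fixes K :: "'a topology"
  assumes "compact_space K" "metrizable_space K"
  obtains \<iota> :: "'a \<Rightarrow> nat \<Rightarrow> real" where "homeomorphic_map K (top_of_set (\<iota> ` topspace K)) \<iota>"
proof -
  obtain M d where "Metric_space M d" and K: "K = Metric_space.mtopology M d"
    using assms(2) unfolding metrizable_space_def by blast
  interpret Metric_space M d by fact
  have top: "topspace K = M" by (simp add: K)
  have "compactin mtopology M" using assms(1) by (simp add: K compact_space_def)
  then have tb: "mtotally_bounded M" by (rule compactin_imp_mtotally_bounded)
  have "\<exists>C. finite C \<and> C \<subseteq> M \<and> M \<subseteq> (\<Union>x\<in>C. mball x (1 / real (Suc n)))" for n
    using tb[unfolded mtotally_bounded_def, rule_format, of "1 / real (Suc n)"] by simp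
  then obtain C where C: "\<And>n. finite (C n) \<and> C n \<subseteq> M \<and> M \<subseteq> (\<Union>x\<in>C n. mball x (1 / real (Suc n)))" by metis
  define E where "E = (\<Union>n. C n)"
  have E: "countable E" "E \<subseteq> M" using C by (auto simp: E_def intro: countable_finite)
  define \<iota> where "\<iota> x k = (if E = {} then 0 else d x (from_nat_into E k))" for x k
  have "continuous_map K euclideanreal (\<lambda>x. \<iota> x k)" for k
  proof (cases "E = {}")
    case False
    have p: "from_nat_into E k \<in> M" by (rule subsetD[OF E(2) from_nat_into[OF False]])
    have "continuous_map mtopology euclideanreal (\<lambda>x. mdist (metric (M, d)) x (from_nat_into E k))"
      by (intro continuous_map_mdist) (use p in auto)
    then show ?thesis using False by (simp add: \<iota>_def K)
  qed (simp add: \<iota>_def)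
  then have "continuous_map K (product_topology (\<lambda>_. euclideanreal) UNIV) \<iota>"
    by (simp add: continuous_map_componentwise_UNIV)
  then have cont: "continuous_map K euclidean \<iota>" by (simp add: euclidean_product_topology)
  have inj: "inj_on \<iota> (topspace K)"
  proof (rule inj_onI)
    fix x y assume x: "x \<in> topspace K" and y: "y \<in> topspace K" and eq: "\<iota> x = \<iota> y"
    have xy: "x \<in> M" "y \<in> M" using x y top by auto
    show "x = y"
    proof (rule ccontr)
      assume "x \<noteq> y"
      then have "d x y / 2 > 0" using xy by simp
      then obtain n where n: "1 / real (Suc n) < d x y / 2" by (rule nat_approx_posE)
      have "x \<in> (\<Union>p\<in>C n. mball p (1 / real (Suc n)))" using C[of n] xy(1) by blast
      then obtain p where p: "p \<in> C n" "x \<in> mball p (1 / real (Suc n))" by blast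
      then have "p \<in> E" by (auto simp: E_def)
      then obtain k where k: "from_nat_into E k = p" using from_nat_into_surj[OF E(1)] by blast
      have "E \<noteq> {}" using \<open>p \<in> E\<close> by auto
      then have "d x p = d y p" using fun_cong[OF eq, of k] k by (simp add: \<iota>_def)
      moreover have "d x p < 1 / real (Suc n)" using p(2) by (simp add: commute)
      moreover have "p \<in> M" using p(1) C[of n] by blast
      ultimately show False using n triangle[OF xy(1) \<open>p \<in> M\<close> xy(2)] commute[of p y] by linarith
    qed
  qed
  have "homeomorphic_map K (top_of_set (\<iota> ` topspace K)) \<iota>"
    by (rule continuous_imp_homeomorphic_map)
      (use cont inj assms(1) in \<open>auto simp: continuous_map_in_subtopology intro!: Hausdorff_space_subtopology\<close>)
  then show ?thesis by (rule that)
qed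

lemma finite_dimensional_empty: "finite_dimensional (subtopology X {})"
  unfolding finite_dimensional_def covering_dim_le_def
  by (intro exI[of _ 0] allI impI, elim conjE, rule_tac x = \<U> in exI) auto

theorem corollary5p5:
  fixes K :: "'a topology"
  assumes "compact_space K"
    and "metrizable_space K"
    and "strongly_countable_dimensional K"
  shows "u_dominated_by K (top_of_set {0..1::real})"
proof -
  obtain \<iota> :: "'a \<Rightarrow> nat \<Rightarrow> real" where \<iota>: "homeomorphic_map K (top_of_set (\<iota> ` topspace K)) \<iota>"
    using compact_metrizable_embeds_in_sequences[OF assms(1,2)] by blast
  define S where "S = \<iota> ` topspace K"
  note \<iota> = \<iota>[folded S_def]
  then have \<iota>_cont: "continuous_map K (top_of_set S) \<iota>" by (rule homeomorphic_imp_continuous_map)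
  have inj: "inj_on \<iota> (topspace K)" using \<iota> by (rule homeomorphic_imp_injective_map)
  obtain \<kappa> where \<kappa>: "homeomorphic_maps K (top_of_set S) \<iota> \<kappa>" using \<iota> unfolding homeomorphic_map_maps by blast
  have "compactin euclidean S"
    unfolding S_def using \<iota>_cont assms(1)
    by (intro image_compactin[of K]) (auto simp: compact_space_def continuous_map_in_subtopology)
  then have S: "compact S" by simp
  obtain \<F> where \<F>: "countable \<F>" "\<Union>\<F> = topspace K"
    "\<And>F. F \<in> \<F> \<Longrightarrow> closedin K F \<and> finite_dimensional (subtopology K F)"
    using assms(3) unfolding strongly_countable_dimensional_def by blast
  \<comment> \<open>Adding the empty set makes the family enumerable even if it is empty.\<close>
  define P where "P n = from_nat_into (insert {} \<F>) n" for n
  have P_in: "P n \<in> insert {} \<F>" for n unfolding P_def by (rule from_nat_into) simp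
  have P: "closedin K (P n)" "finite_dimensional (subtopology K (P n))" for n
  proof -
    consider "P n = {}" | "P n \<in> \<F>" using P_in[of n] by blast
    then have "closedin K (P n) \<and> finite_dimensional (subtopology K (P n))"
    proof cases
      case 1
      show ?thesis unfolding 1 using finite_dimensional_empty[of K] by simp
    qed (rule \<F>(3))
    then show "closedin K (P n)" "finite_dimensional (subtopology K (P n))" by auto
  qed
  have "range P = insert {} \<F>" unfolding P_def using \<F>(1) by (intro range_from_nat_into) auto
  then have P_Un: "(\<Union>n. P n) = topspace K" using \<F>(2) by simp
  define F where "F n = \<iota> ` P n" for n
  have P_sub: "P n \<subseteq> topspace K" for n using P(1) by (rule closedin_subset)
  have F_sub: "F n \<subseteq> S" for n using P_sub by (auto simp: F_def S_def)
  have clF: "closed (F n)" for n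
  proof -
    have "closedin (top_of_set S) (F n)"
      using homeomorphic_imp_closed_map[OF \<iota>] P(1)[of n] by (simp add: closed_map_def F_def)
    then show ?thesis using compact_imp_closed[OF S] by (rule closedin_closed_trans)
  qed
  have dimF: "finite_dimensional (top_of_set (F n))" for n
  proof -
    have "homeomorphic_map (subtopology K (P n)) (subtopology (top_of_set S) (F n)) \<iota>"
      by (rule homeomorphic_map_subtopologies[OF \<iota>]) (use P_sub[of n] F_sub[of n] in \<open>auto simp: F_def\<close>)
    moreover have "subtopology (top_of_set S) (F n) = top_of_set (F n)"
      using F_sub[of n] by (simp add: subtopology_subtopology Int_absorb1)
    ultimately have "homeomorphic_map (subtopology K (P n)) (top_of_set (F n)) \<iota>" by simp
    from covering_dim_le_homeomorphic_map[OF this] show ?thesis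
      using P(2)[of n] unfolding finite_dimensional_def by blast
  qed
  have S_Un: "S = (\<Union>n. F n)" unfolding F_def S_def P_Un[symmetric] by blast
  obtain \<Phi> :: "(real \<Rightarrow> real) \<Rightarrow> (nat \<Rightarrow> real) \<Rightarrow> real" where
    \<Phi>: "\<And>G. continuous_on {0..1} G \<Longrightarrow> continuous_on S (\<Phi> G)"
    "\<And>f. continuous_on S f \<Longrightarrow> \<exists>G. continuous_on {0..1} G \<and> (\<forall>x\<in>S. \<Phi> G x = f x)"
    "\<And>x. x \<in> S \<Longrightarrow> finitely_lipschitz (\<lambda>G. \<Phi> G x) {0..1}"
    by (rule existence_of_gluing[OF S S_Un clF dimF], (assumption | rule that)+)
  let ?I = "top_of_set {0..1::real}"
  define \<phi> where "\<phi> G = (\<lambda>y\<in>topspace K. \<Phi> G (\<iota> y))" for G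
  have Cp_I: "G \<in> topspace (Cp ?I) \<longleftrightarrow> G \<in> extensional {0..1} \<and> continuous_on {0..1} G" for G
    by (auto simp: Cp_def PiE_def)
  have Cp_K: "f \<in> topspace (Cp K) \<longleftrightarrow> f \<in> extensional (topspace K) \<and> continuous_map K euclideanreal f" for f
    by (auto simp: Cp_def PiE_def)
  have maps: "\<phi> G \<in> topspace (Cp K)" if "continuous_on {0..1} G" for G
  proof -
    have "continuous_map (top_of_set S) euclideanreal (\<Phi> G)" using \<Phi>(1)[OF that] by simp
    from continuous_map_compose[OF \<iota>_cont this]
    have "continuous_map K euclideanreal (\<phi> G)"
      by (rule continuous_map_eq) (simp add: \<phi>_def)
    then show ?thesis unfolding Cp_K by (simp add: \<phi>_def)
  qed
  have "Cp_uniformly_continuous ?I K \<phi>"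
  proof (rule finitely_lipschitz_imp_Cp_uniformly_continuous)
    show "\<phi> \<in> topspace (Cp ?I) \<rightarrow> topspace (Cp K)" using maps Cp_I by blast
    show "finitely_lipschitz (\<lambda>G. \<phi> G y) (topspace ?I)" if "y \<in> topspace K" for y
      using \<Phi>(3)[of "\<iota> y"] that by (simp add: \<phi>_def S_def)
  qed
  moreover have "\<phi> ` topspace (Cp ?I) = topspace (Cp K)"
  proof
    show "\<phi> ` topspace (Cp ?I) \<subseteq> topspace (Cp K)" using maps Cp_I by blast
    show "topspace (Cp K) \<subseteq> \<phi> ` topspace (Cp ?I)"
    proof
      fix f assume "f \<in> topspace (Cp K)"
      then have f: "f \<in> extensional (topspace K)" "continuous_map K euclideanreal f" using Cp_K by auto
      have "continuous_map (top_of_set S) euclideanreal (f \<circ> \<kappa>)"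
        using \<kappa> f(2) unfolding homeomorphic_maps_def by (intro continuous_map_compose[of _ K]) auto
      then have "continuous_on S (f \<circ> \<kappa>)" by simp
      then obtain G where G: "continuous_on {0..1} G" "\<forall>x\<in>S. \<Phi> G x = (f \<circ> \<kappa>) x" using \<Phi>(2) by blast
      \<comment> \<open>Elements of the function space have to be undefined outside the unit interval; the gluing map only looks at values inside.\<close>
      define G' where "G' = restrict G {0..1}"
      have G'_cont: "continuous_on {0..1} G'" by (rule continuous_on_eq[OF G(1)]) (simp add: G'_def)
      have "\<Phi> G' x = \<Phi> G x" if x: "x \<in> S" for x
      proof -
        obtain A C where A: "A \<subseteq> {0..1}" and le: "\<And>f g. \<bar>\<Phi> f x - \<Phi> g x\<bar> \<le> C * (\<Sum>a\<in>A. \<bar>f a - g a\<bar>)"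
          using \<Phi>(3)[OF x] unfolding finitely_lipschitz_def by auto
        have "(\<Sum>a\<in>A. \<bar>G' a - G a\<bar>) = 0" using A by (intro sum.neutral) (auto simp: G'_def)
        then show ?thesis using le[of G' G] by simp
      qed
      then have "\<phi> G' = f"
        using f(1) G(2) \<kappa> by (intro extensionalityI[of _ "topspace K"])
          (auto simp: \<phi>_def S_def homeomorphic_maps_def)
      moreover have "G' \<in> topspace (Cp ?I)" using G'_cont Cp_I by (simp add: G'_def)
      ultimately show "f \<in> \<phi> ` topspace (Cp ?I)" by blast
    qed
  qed
  ultimately show ?thesis unfolding u_dominated_by_def by blast
qed

end
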